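(* Let $n > 0$ and let $G \leq \mathrm{Sym}(X)$ be a permutation group. If $G$ is $(n+1)$-transitive and the point-stabilisers are soluble of derived length at most $n$, then one of the following holds. (i) $n=1$ and $G$ is the group of affine maps $x \mapsto ax+b$ ($a \in k^\times$, $b \in k$) over a field $k$, and $X = \mathbb{A}^1(k)$ is the affine line. (ii) $n=2$ and there is a field $k$ such that $G = \mathrm{PGL}_2(k)$, and $X = \mathbb{P}^1(k)$. (iii) $n=3$ and $G = \mathrm{Sym}(4)$ or $G = \mathrm{Sym}(5)$. (iv) $n=4$ and $G = \mathrm{Sym}(5)$.
   Context: Fields are commutative. A permutation group on $X$ is $m$-transitive if it is transitive on ordered $m$-tuples of pairwise distinct elements of $X$ (with $|X| \geq m$). $X$ may be infinite. The identifications in (i) and (ii) are as permutation groups; $\mathrm{PGL}_2(k)$ acts in the standard way on the projective line $\mathbb{P}^1(k)$. In (iii) and (iv), $\mathrm{Sym}(m)$ acts naturally on $m$ points. *)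

theory Defs
  imports "HOL-Algebra.Algebra"
begin

section \<open>Permutation groups\<close>

text \<open>A permutation group on \<open>\<Omega>\<close> is a subgroup \<open>G\<close> of the library group \<open>BijGroup \<Omega>\<close>. Its elements
  are extensional, so \<open>G\<close> acts on \<open>\<Omega>\<close> by application of functions.\<close>

definition perm_group :: "'x set \<Rightarrow> ('x \<Rightarrow> 'x) set \<Rightarrow> ('x \<Rightarrow> 'x) monoid"
  where "perm_group \<Omega> G = (BijGroup \<Omega>)\<lparr>carrier := G\<rparr>"

text \<open>The cardinality condition is phrased so that infinite sets, whose \<open>card\<close> is \<open>0\<close>, are admitted.\<close>

definition multiply_transitive :: "nat \<Rightarrow> 'x set \<Rightarrow> ('x \<Rightarrow> 'x) set \<Rightarrow> bool"
  where "multiply_transitive m \<Omega> G \<longleftrightarrow>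
    (infinite \<Omega> \<or> m \<le> card \<Omega>) \<and>
    (\<forall>xs ys. length xs = m \<and> distinct xs \<and> set xs \<subseteq> \<Omega> \<and>
             length ys = m \<and> distinct ys \<and> set ys \<subseteq> \<Omega> \<longrightarrow>
             (\<exists>g\<in>G. map g xs = ys))"

text \<open>\<open>H\<close> is a subgroup of \<open>G\<close>. The derived series reaches the trivial subgroup after at most \<open>n\<close>
  steps iff its \<open>n\<close>-th term is trivial.\<close>

definition soluble_of_length_le :: "('g, 'm) monoid_scheme \<Rightarrow> nat \<Rightarrow> 'g set \<Rightarrow> bool"
  where "soluble_of_length_le G n H \<longleftrightarrow> (derived G ^^ n) H = {\<one>\<^bsub>G\<^esub>}"

text \<open>Isomorphism of a group acting on a set with another group acting on another set. Two
  faithful actions are isomorphic iff they are identified as permutation groups. When \<open>\<Omega>\<close> is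
  isomorphic to a line, affine or projective, over a field \<open>K\<close>, the carrier of \<open>K\<close> embeds in \<open>\<Omega>\<close>. So
  taking the elements of \<open>K\<close> from the type of the points of \<open>\<Omega>\<close> loses no generality.\<close>

definition action_iso ::
  "('g, 'm) monoid_scheme \<Rightarrow> 'x set \<Rightarrow> ('g \<Rightarrow> 'x \<Rightarrow> 'x) \<Rightarrow>
   ('h, 'n) monoid_scheme \<Rightarrow> 'y set \<Rightarrow> ('h \<Rightarrow> 'y \<Rightarrow> 'y) \<Rightarrow> bool"
  where "action_iso G \<Omega> \<phi> H Y \<psi> \<longleftrightarrow>
    (\<exists>h f. h \<in> iso G H \<and> bij_betw f \<Omega> Y \<and>
           (\<forall>g\<in>carrier G. \<forall>x\<in>\<Omega>. f (\<phi> g x) = \<psi> (h g) (f x)))"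


section \<open>Affine maps of the line\<close>

definition affine_maps :: "('a, 'm) ring_scheme \<Rightarrow> ('a \<Rightarrow> 'a) set"
  where "affine_maps K =
    {\<lambda>x\<in>carrier K. (a \<otimes>\<^bsub>K\<^esub> x) \<oplus>\<^bsub>K\<^esub> b | a b. a \<in> Units K \<and> b \<in> carrier K}"


section \<open>The projective line and \<open>PGL\<^sub>2\<close>\<close>

text \<open>The tuple \<open>(a, b, c, d)\<close> is the matrix with rows \<open>(a, b)\<close> and \<open>(c, d)\<close>. Matrices act on
  column vectors from the left.\<close>

type_synonym 'a mat2 = "'a \<times> 'a \<times> 'a \<times> 'a"

fun mat2_mult :: "('a, 'm) ring_scheme \<Rightarrow> 'a mat2 \<Rightarrow> 'a mat2 \<Rightarrow> 'a mat2"
  where "mat2_mult K (a, b, c, d) (a', b', c', d') =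
    ((a \<otimes>\<^bsub>K\<^esub> a') \<oplus>\<^bsub>K\<^esub> (b \<otimes>\<^bsub>K\<^esub> c'), (a \<otimes>\<^bsub>K\<^esub> b') \<oplus>\<^bsub>K\<^esub> (b \<otimes>\<^bsub>K\<^esub> d'),
     (c \<otimes>\<^bsub>K\<^esub> a') \<oplus>\<^bsub>K\<^esub> (d \<otimes>\<^bsub>K\<^esub> c'), (c \<otimes>\<^bsub>K\<^esub> b') \<oplus>\<^bsub>K\<^esub> (d \<otimes>\<^bsub>K\<^esub> d'))"

fun mat2_vec :: "('a, 'm) ring_scheme \<Rightarrow> 'a mat2 \<Rightarrow> 'a \<times> 'a \<Rightarrow> 'a \<times> 'a"
  where "mat2_vec K (a, b, c, d) (x, y) =
    ((a \<otimes>\<^bsub>K\<^esub> x) \<oplus>\<^bsub>K\<^esub> (b \<otimes>\<^bsub>K\<^esub> y), (c \<otimes>\<^bsub>K\<^esub> x) \<oplus>\<^bsub>K\<^esub> (d \<otimes>\<^bsub>K\<^esub> y))"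

definition GL2 :: "('a, 'm) ring_scheme \<Rightarrow> 'a mat2 monoid"
  where "GL2 K =
    \<lparr>carrier = {(a, b, c, d). a \<in> carrier K \<and> b \<in> carrier K \<and> c \<in> carrier K \<and> d \<in> carrier K \<and>
                  (a \<otimes>\<^bsub>K\<^esub> d) \<ominus>\<^bsub>K\<^esub> (b \<otimes>\<^bsub>K\<^esub> c) \<in> Units K},
     monoid.mult = mat2_mult K,
     monoid.one = (\<one>\<^bsub>K\<^esub>, \<zero>\<^bsub>K\<^esub>, \<zero>\<^bsub>K\<^esub>, \<one>\<^bsub>K\<^esub>)\<rparr>"

definition scalar_mats2 :: "('a, 'm) ring_scheme \<Rightarrow> 'a mat2 set"
  where "scalar_mats2 K = {(a, \<zero>\<^bsub>K\<^esub>, \<zero>\<^bsub>K\<^esub>, a) | a. a \<in> Units K}"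

definition PGL2 :: "('a, 'm) ring_scheme \<Rightarrow> 'a mat2 set monoid"
  where "PGL2 K = GL2 K Mod scalar_mats2 K"

fun line_through :: "('a, 'm) ring_scheme \<Rightarrow> 'a \<times> 'a \<Rightarrow> ('a \<times> 'a) set"
  where "line_through K (x, y) = {(t \<otimes>\<^bsub>K\<^esub> x, t \<otimes>\<^bsub>K\<^esub> y) | t. t \<in> carrier K}"

definition proj_line :: "('a, 'm) ring_scheme \<Rightarrow> ('a \<times> 'a) set set"
  where "proj_line K = line_through K ` (carrier K \<times> carrier K - {(\<zero>\<^bsub>K\<^esub>, \<zero>\<^bsub>K\<^esub>)})"

text \<open>An element of \<open>PGL2 K\<close> is a coset \<open>C\<close> of matrices. All of them map a given line \<open>L\<close> to the
  same line, so the union below is the image of \<open>L\<close> under any representative of \<open>C\<close>.\<close>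

definition PGL2_act :: "('a, 'm) ring_scheme \<Rightarrow> 'a mat2 set \<Rightarrow> ('a \<times> 'a) set \<Rightarrow> ('a \<times> 'a) set"
  where "PGL2_act K C = (\<lambda>L\<in>proj_line K. \<Union>M\<in>C. mat2_vec K M ` L)"

end

theory Submission
  imports Defs
begin

text \<open>
Write \<open>G\<^sub>x\<close> for the stabilizer of a point \<open>x\<close>. Transitivity and solubility pull against each other: if a
group \<open>H\<close> acts faithfully and 2-transitively on \<open>Y\<close> and is soluble of length at most \<open>m + 1\<close>, then the
last non-trivial term of its derived series is abelian and normal, hence regular on \<open>Y\<close>, so it meets
the stabilizer of a point of \<open>Y\<close> trivially and this stabilizer has length at most \<open>m\<close>
(\<open>derived_length_stabilizer\<close>). Each further fixed point of \<open>\<Omega>\<close> therefore costs one step of the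
derived series.

For \<open>n = 1\<close> the group is 2-transitive with abelian point stabilizers, hence sharply 2-transitive. Such a
group has coordinates: an addition, read off from products of involutions, and a multiplication, read
off from the stabilizer of \<open>0\<close>. They satisfy the axioms of a field, except that \<open>a + (b + x)\<close> and
\<open>(a + b) + x\<close> differ by a factor \<open>d\<^sub>a\<^sub>b\<close> at \<open>x\<close>. Since multiplication is commutative, the product
\<open>(1 + q)(1 + r)\<close> can be expanded in two orders, and the comparison forces \<open>d\<^sub>a\<^sub>b = 1\<close> (\<open>d_eq_one\<close>).

For \<open>n = 2\<close> the stabilizer of a point \<open>\<infinity>\<close> is of the kind treated for \<open>n = 1\<close>, so it is the affine group
of a field \<open>K\<close>. The element \<open>s\<close> of \<open>G\<close> that swaps \<open>0\<close> and \<open>\<infinity>\<close> and fixes \<open>1\<close> is multiplicative on the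
units, and because it generates a copy of \<open>Sym(3)\<close> together with \<open>x \<mapsto> 1 - x\<close>, it satisfies
\<open>s (1 - s x) = 1 - s (1 - x)\<close>. This leaves only \<open>s x = 1/x\<close> (\<open>eq_inverse_if_unit_relation\<close>), and \<open>G\<close> is
generated by \<open>s\<close> and the affine maps.

For \<open>n \<ge> 3\<close> the stabilizer of \<open>p\<close> contains an abelian normal subgroup \<open>A\<close> that is regular on the other
points. After the choice of a base point \<open>q\<close> these points become the elements of \<open>A\<close>, and the
permutations fixing \<open>p\<close> and \<open>q\<close> act by automorphisms of \<open>A\<close>. Automorphisms are too rigid for a highly
transitive action on a large set, which gives \<open>|\<Omega>| \<le> 5\<close> (\<open>card_le_five\<close>). What is left is the full
symmetric group.
\<close>

section \<open>Near-domains with commutative multiplication\<close>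

text \<open>A near-domain is the coordinate structure of a sharply 2-transitive group; here its
  multiplication is commutative. The factor \<open>d x y\<close> measures the failure of associativity of the
  addition. The last axiom reflects that a stabilizer without involutions is the source of
  characteristic two: there \<open>neg\<close> is the identity, and \<open>x\<^sup>2 = 1\<close> has one solution only.\<close>
locale commutative_near_domain =
  fixes F :: "'a set"
    and add :: "'a \<Rightarrow> 'a \<Rightarrow> 'a" (infixl "\<^bold>+" 65)
    and mul :: "'a \<Rightarrow> 'a \<Rightarrow> 'a" (infixl "\<^bold>*" 70)
    and zero :: 'a ("\<^bold>0") and one :: 'a ("\<^bold>1")
    and neg :: "'a \<Rightarrow> 'a"
    and d :: "'a \<Rightarrow> 'a \<Rightarrow> 'a"
  assumes add_closed [simp, intro]: "\<lbrakk>x \<in> F; y \<in> F\<rbrakk> \<Longrightarrow> x \<^bold>+ y \<in> F"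
    and mul_closed [simp, intro]: "\<lbrakk>x \<in> F; y \<in> F\<rbrakk> \<Longrightarrow> x \<^bold>* y \<in> F"
    and zero_closed [simp, intro]: "\<^bold>0 \<in> F"
    and one_closed [simp, intro]: "\<^bold>1 \<in> F"
    and neg_closed [simp, intro]: "x \<in> F \<Longrightarrow> neg x \<in> F"
    and d_closed [simp, intro]: "\<lbrakk>x \<in> F; y \<in> F\<rbrakk> \<Longrightarrow> d x y \<in> F"
    and one_not_zero: "\<^bold>1 \<noteq> \<^bold>0"
    and d_not_zero: "\<lbrakk>x \<in> F; y \<in> F\<rbrakk> \<Longrightarrow> d x y \<noteq> \<^bold>0"
    and mul_assoc: "\<lbrakk>x \<in> F; y \<in> F; z \<in> F\<rbrakk> \<Longrightarrow> (x \<^bold>* y) \<^bold>* z = x \<^bold>* (y \<^bold>* z)"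
    and mul_comm: "\<lbrakk>x \<in> F; y \<in> F\<rbrakk> \<Longrightarrow> x \<^bold>* y = y \<^bold>* x"
    and one_mul [simp]: "x \<in> F \<Longrightarrow> \<^bold>1 \<^bold>* x = x"
    and mul_zero [simp]: "x \<in> F \<Longrightarrow> x \<^bold>* \<^bold>0 = \<^bold>0"
    and inverse_ex: "\<lbrakk>x \<in> F; x \<noteq> \<^bold>0\<rbrakk> \<Longrightarrow> \<exists>y\<in>F. y \<^bold>* x = \<^bold>1"
    and distrib: "\<lbrakk>x \<in> F; y \<in> F; z \<in> F\<rbrakk> \<Longrightarrow> x \<^bold>* (y \<^bold>+ z) = x \<^bold>* y \<^bold>+ x \<^bold>* z"
    and zero_add [simp]: "x \<in> F \<Longrightarrow> \<^bold>0 \<^bold>+ x = x"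
    and add_zero [simp]: "x \<in> F \<Longrightarrow> x \<^bold>+ \<^bold>0 = x"
    and neg_add_cancel: "\<lbrakk>x \<in> F; y \<in> F\<rbrakk> \<Longrightarrow> neg x \<^bold>+ (x \<^bold>+ y) = y"
    and near_assoc: "\<lbrakk>x \<in> F; y \<in> F; z \<in> F\<rbrakk> \<Longrightarrow> x \<^bold>+ (y \<^bold>+ z) = (x \<^bold>+ y) \<^bold>+ d x y \<^bold>* z"
    and near_comm: "\<lbrakk>x \<in> F; y \<in> F\<rbrakk> \<Longrightarrow> x \<^bold>+ y = d x y \<^bold>* (y \<^bold>+ x)"
    and no_involution_if_char_two:
      "\<lbrakk>w \<in> F; w \<noteq> \<^bold>0; neg w = w; x \<in> F; x \<^bold>* x = \<^bold>1\<rbrakk> \<Longrightarrow> x = \<^bold>1"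
begin

lemma add_left_cancel: "\<lbrakk>x \<in> F; y \<in> F; z \<in> F\<rbrakk> \<Longrightarrow> x \<^bold>+ y = x \<^bold>+ z \<longleftrightarrow> y = z"
  by (metis neg_add_cancel)

lemma add_neg: "x \<in> F \<Longrightarrow> x \<^bold>+ neg x = \<^bold>0"
  by (metis add_zero neg_add_cancel add_closed neg_closed zero_closed)

lemma add_neg_cancel: "\<lbrakk>x \<in> F; y \<in> F\<rbrakk> \<Longrightarrow> x \<^bold>+ (neg x \<^bold>+ y) = y"
  by (metis neg_add_cancel add_closed neg_closed)

lemma mul_left_cancel:
  assumes "c \<in> F" "c \<noteq> \<^bold>0" "x \<in> F" "y \<in> F"
  shows "c \<^bold>* x = c \<^bold>* y \<longleftrightarrow> x = y"
  by (metis assms inverse_ex mul_assoc one_mul)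

lemma mul_one [simp]: "x \<in> F \<Longrightarrow> x \<^bold>* \<^bold>1 = x"
  by (metis mul_comm one_closed one_mul)

lemma mul_not_zero: "\<lbrakk>x \<in> F; y \<in> F; x \<noteq> \<^bold>0; y \<noteq> \<^bold>0\<rbrakk> \<Longrightarrow> x \<^bold>* y \<noteq> \<^bold>0"
  by (metis mul_left_cancel mul_zero zero_closed)

lemma mul_eq_self: "\<lbrakk>c \<in> F; x \<in> F; x \<noteq> \<^bold>0; c \<^bold>* x = x\<rbrakk> \<Longrightarrow> c = \<^bold>1"
  by (metis mul_left_cancel mul_comm one_closed one_mul)

lemma distrib_right: "\<lbrakk>x \<in> F; y \<in> F; z \<in> F\<rbrakk> \<Longrightarrow> (y \<^bold>+ z) \<^bold>* x = y \<^bold>* x \<^bold>+ z \<^bold>* x"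
  by (metis distrib mul_comm add_closed)

lemma solve_mul: "\<lbrakk>c \<in> F; c \<noteq> \<^bold>0; x \<in> F\<rbrakk> \<Longrightarrow> \<exists>y\<in>F. c \<^bold>* y = x"
  by (metis inverse_ex mul_assoc mul_closed mul_comm one_mul)

lemma d_homogeneous:
  assumes "c \<in> F" "c \<noteq> \<^bold>0" "a \<in> F" "b \<in> F"
  shows "d (c \<^bold>* a) (c \<^bold>* b) = d a b"
proof -
  have "(c \<^bold>* a \<^bold>+ c \<^bold>* b) \<^bold>+ d (c \<^bold>* a) (c \<^bold>* b) \<^bold>* (c \<^bold>* \<^bold>1) = c \<^bold>* a \<^bold>+ (c \<^bold>* b \<^bold>+ c \<^bold>* \<^bold>1)"
    using assms by (simp add: near_assoc)
  also have "\<dots> = c \<^bold>* ((a \<^bold>+ b) \<^bold>+ d a b \<^bold>* \<^bold>1)"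
    using assms by (simp add: distrib flip: near_assoc del: mul_one)
  also have "\<dots> = (c \<^bold>* a \<^bold>+ c \<^bold>* b) \<^bold>+ c \<^bold>* d a b"
    using assms by (simp add: distrib)
  finally have "d (c \<^bold>* a) (c \<^bold>* b) \<^bold>* c = c \<^bold>* d a b"
    using assms by (simp add: add_left_cancel)
  then show ?thesis using assms by (metis mul_comm mul_left_cancel d_closed mul_closed)
qed

text \<open>Both sides, after adding \<open>1\<close> from the left, are expansions of \<open>(1 + q)(1 + r)\<close>; the two
  expansions differ in the factor that is distributed first.\<close>
lemma medial_one:
  assumes "q \<in> F" "r \<in> F"
  shows "q \<^bold>+ (r \<^bold>* q \<^bold>+ r) = r \<^bold>+ (r \<^bold>* q \<^bold>+ q)"
proof -
  have expand: "\<^bold>1 \<^bold>+ (a \<^bold>+ (b \<^bold>* a \<^bold>+ b)) = (\<^bold>1 \<^bold>+ a) \<^bold>* (\<^bold>1 \<^bold>+ b)" if "a \<in> F" "b \<in> F" for a b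
  proof -
    have "(\<^bold>1 \<^bold>+ a) \<^bold>* (\<^bold>1 \<^bold>+ b) = (\<^bold>1 \<^bold>+ a) \<^bold>+ b \<^bold>* (\<^bold>1 \<^bold>+ a)"
      using that by (simp add: distrib mul_comm)
    also have "\<dots> = (\<^bold>1 \<^bold>+ a) \<^bold>+ d \<^bold>1 a \<^bold>* (b \<^bold>* (a \<^bold>+ \<^bold>1))"
      using that near_comm[of "\<^bold>1" a] by (metis add_closed d_closed mul_assoc mul_comm one_closed)
    also have "\<dots> = \<^bold>1 \<^bold>+ (a \<^bold>+ b \<^bold>* (a \<^bold>+ \<^bold>1))"
      using that by (simp add: near_assoc)
    finally show ?thesis using that by (simp add: distrib)
  qed
  have "\<^bold>1 \<^bold>+ (q \<^bold>+ (r \<^bold>* q \<^bold>+ r)) = \<^bold>1 \<^bold>+ (r \<^bold>+ (r \<^bold>* q \<^bold>+ q))"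
    using expand[of q r] expand[of r q] assms by (metis add_closed mul_comm one_closed)
  then show ?thesis using assms by (simp add: add_left_cancel)
qed

text \<open>The previous identity is homogeneous: multiplied by \<open>p\<close> it reads \<open>q + (s + r) = r + (s + q)\<close> with
  \<open>p s = q r\<close>. Any three non-zero elements arise in this way from a suitable \<open>p\<close>.\<close>
lemma swap_outer:
  assumes "q \<in> F" "r \<in> F" "s \<in> F" "q \<noteq> \<^bold>0" "r \<noteq> \<^bold>0" "s \<noteq> \<^bold>0"
  shows "q \<^bold>+ (s \<^bold>+ r) = r \<^bold>+ (s \<^bold>+ q)"
proof -
  obtain t where t: "t \<in> F" "s \<^bold>* t = r" using solve_mul assms by blast
  have t0: "t \<noteq> \<^bold>0" using t assms by auto
  define p where "p = t \<^bold>* q"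
  have p: "p \<in> F" "p \<noteq> \<^bold>0" unfolding p_def using t assms t0 mul_not_zero by auto
  obtain q' where q': "q' \<in> F" "p \<^bold>* q' = q" using solve_mul p assms by blast
  obtain r' where r': "r' \<in> F" "p \<^bold>* r' = r" using solve_mul p assms by blast
  have "q \<^bold>* (t \<^bold>* q') = q \<^bold>* \<^bold>1"
    using q' t assms unfolding p_def by (metis mul_assoc mul_closed mul_comm mul_one)
  then have tq: "t \<^bold>* q' = \<^bold>1" using assms t q' by (metis mul_closed mul_left_cancel one_closed)
  have "p \<^bold>* (r' \<^bold>* q') = r \<^bold>* q'" using p q' r' by (metis mul_assoc)
  also have "\<dots> = s \<^bold>* (t \<^bold>* q')" using t q' assms by (metis mul_assoc)
  finally have 2: "p \<^bold>* (r' \<^bold>* q') = s" using tq assms by simp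
  have "p \<^bold>* (q' \<^bold>+ (r' \<^bold>* q' \<^bold>+ r')) = p \<^bold>* (r' \<^bold>+ (r' \<^bold>* q' \<^bold>+ q'))"
    using medial_one[of q' r'] q' r' by metis
  then show ?thesis using q' r' p 2 by (simp add: distrib)
qed

lemma d_eq_one_if_sum_zero:
  assumes "a \<in> F" "b \<in> F" "a \<^bold>+ b = \<^bold>0"
  shows "d a b = \<^bold>1"
proof -
  have "b = neg a" using assms add_neg add_left_cancel by (metis neg_closed)
  then have "\<^bold>1 = (a \<^bold>+ b) \<^bold>+ d a b \<^bold>* \<^bold>1"
    using assms add_neg_cancel near_assoc one_closed by metis
  then show ?thesis using assms by simp
qed

lemma d_inverse:
  assumes "a \<in> F" "b \<in> F"
  shows "d a b \<^bold>* d b a = \<^bold>1"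
proof (cases "a \<^bold>+ b = \<^bold>0")
  case True
  then have "b \<^bold>+ a = \<^bold>0" using assms near_comm
    by (metis add_closed d_closed d_not_zero mul_not_zero)
  then show ?thesis using True assms d_eq_one_if_sum_zero by simp
next
  case False
  have "(d a b \<^bold>* d b a) \<^bold>* (a \<^bold>+ b) = a \<^bold>+ b"
    using assms near_comm by (metis add_closed d_closed mul_assoc)
  then show ?thesis using assms False by (meson mul_eq_self add_closed d_closed mul_closed)
qed

text \<open>The point of this identity is that the factor depends on \<open>q\<close> and \<open>s\<close>, whereas the two sums
  involve only \<open>q + s\<close> and an arbitrary \<open>r\<close>.\<close>
lemma d_twisted_comm:
  assumes "q \<in> F" "s \<in> F" "r \<in> F" "q \<noteq> \<^bold>0" "s \<noteq> \<^bold>0" "r \<noteq> \<^bold>0"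
  shows "d q s \<^bold>* ((q \<^bold>+ s) \<^bold>+ r) = r \<^bold>+ (q \<^bold>+ s)"
proof -
  obtain r' where r': "r' \<in> F" "d q s \<^bold>* r' = r" using solve_mul assms d_not_zero by blast
  then have "r' \<noteq> \<^bold>0" using assms by auto
  have "(q \<^bold>+ s) \<^bold>+ r = q \<^bold>+ (s \<^bold>+ r')" using r' assms by (simp add: near_assoc)
  also have "\<dots> = r' \<^bold>+ (s \<^bold>+ q)" using swap_outer assms r' \<open>r' \<noteq> \<^bold>0\<close> by simp
  finally have "d q s \<^bold>* ((q \<^bold>+ s) \<^bold>+ r) = d q s \<^bold>* r' \<^bold>+ d q s \<^bold>* (s \<^bold>+ q)"
    using assms r' by (simp add: distrib)
  then show ?thesis using r' assms near_comm[of q s] by simp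
qed

text \<open>Put \<open>w = q + s\<close>. Taking \<open>r = w\<close> in the twisted commutativity settles the case \<open>w + w \<noteq> 0\<close>. If
  \<open>w + w = 0\<close>, comparison with \<open>near_comm\<close> shows that \<open>d r w\<close> is the same for all admissible \<open>r\<close>. As
  \<open>q + s\<close> and \<open>s + q\<close> are proportional, \<open>d q s\<close> then equals \<open>d s q\<close>, its own inverse, and
  the absence of involutions applies.\<close>
lemma d_eq_one:
  assumes "q \<in> F" "s \<in> F"
  shows "d q s = \<^bold>1"
proof -
  define w where "w = q \<^bold>+ s"
  have w [simp]: "w \<in> F" using assms w_def by simp
  consider "q = \<^bold>0" | "s = \<^bold>0" | "w = \<^bold>0" | "q \<noteq> \<^bold>0" "s \<noteq> \<^bold>0" "w \<noteq> \<^bold>0" "w \<^bold>+ w \<noteq> \<^bold>0"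
    | "q \<noteq> \<^bold>0" "s \<noteq> \<^bold>0" "w \<noteq> \<^bold>0" "w \<^bold>+ w = \<^bold>0" by blast
  then show ?thesis
  proof cases
    case 1
    then have "s \<^bold>+ \<^bold>1 = s \<^bold>+ d q s \<^bold>* \<^bold>1"
      using near_assoc[of q s "\<^bold>1"] assms by simp
    then show ?thesis using assms by (simp add: add_left_cancel)
  next
    case 2
    then have "q \<^bold>+ \<^bold>1 = q \<^bold>+ d q s \<^bold>* \<^bold>1"
      using near_assoc[of q s "\<^bold>1"] assms by simp
    then show ?thesis using assms by (simp add: add_left_cancel)
  next
    case 3
    then show ?thesis using assms d_eq_one_if_sum_zero w_def by simp
  next
    case 4
    then have "d q s \<^bold>* (w \<^bold>+ w) = w \<^bold>+ w" using d_twisted_comm[of q s w] assms w_def by simp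
    then show ?thesis using 4 assms by (meson mul_eq_self w add_closed d_closed)
  next
    case 5
    have const: "d r (a \<^bold>+ b) = d a b"
      if "a \<in> F" "b \<in> F" "r \<in> F" "a \<noteq> \<^bold>0" "b \<noteq> \<^bold>0" "r \<noteq> \<^bold>0" "r \<noteq> a \<^bold>+ b"
        "(a \<^bold>+ b) \<^bold>+ (a \<^bold>+ b) = \<^bold>0" for a b r
    proof -
      have n: "(a \<^bold>+ b) \<^bold>+ r \<noteq> \<^bold>0" using that by (metis add_left_cancel add_closed)
      have "((a \<^bold>+ b) \<^bold>+ r) \<^bold>* d a b = r \<^bold>+ (a \<^bold>+ b)"
        using d_twisted_comm that by (metis mul_comm add_closed d_closed)
      also have "\<dots> = ((a \<^bold>+ b) \<^bold>+ r) \<^bold>* d r (a \<^bold>+ b)"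
        using near_comm that by (metis mul_comm add_closed d_closed)
      finally show ?thesis using n that by (metis mul_left_cancel add_closed d_closed)
    qed
    define w' where "w' = s \<^bold>+ q"
    have w': "w' \<in> F" using assms w'_def by simp
    have ww': "w = d q s \<^bold>* w'" unfolding w_def w'_def using assms by (rule near_comm)
    have "d q s \<^bold>* (w' \<^bold>+ w') = \<^bold>0" using 5 ww' w' assms by (simp add: distrib)
    then have ww0: "w' \<^bold>+ w' = \<^bold>0" using w' assms d_not_zero mul_not_zero by blast
    have sw: "s \<noteq> w'" unfolding w'_def using 5 assms add_left_cancel[of s q "\<^bold>0"] by auto
    have ds: "d q s \<^bold>* s \<in> F" "d q s \<^bold>* s \<noteq> \<^bold>0" "d q s \<^bold>* s \<noteq> w"
      using assms 5 sw w' ww' d_not_zero mul_not_zero by (auto simp: mul_left_cancel)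
    \<comment> \<open>The factor \<open>d s q\<close> belongs to the sum \<open>w'\<close>, and \<open>d q s\<close> to \<open>w = d q s * w'\<close>; scaling carries one to the other.\<close>
    have "d s w' = d s q" unfolding w'_def
      using const[of s q s] ww0 sw 5 assms unfolding w'_def by simp
    moreover have "d (d q s \<^bold>* s) (d q s \<^bold>* w') = d s w'"
      using d_homogeneous assms w' d_not_zero by simp
    moreover have "d (d q s \<^bold>* s) w = d q s"
      using const[of q s "d q s \<^bold>* s"] 5 ds assms unfolding w_def by simp
    ultimately have "d s q = d q s" using ww' by simp
    then have "d q s \<^bold>* d q s = \<^bold>1" using d_inverse[OF assms] by simp
    moreover have "neg w = w" using 5 add_neg w by (metis add_left_cancel neg_closed)
    ultimately show ?thesis using no_involution_if_char_two[of w "d q s"] 5 assms by simp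
  qed
qed

theorem near_domain_is_field: "field \<lparr>carrier = F, monoid.mult = mul, monoid.one = \<^bold>1, ring.zero = \<^bold>0, ring.add = add\<rparr>" (is "field ?K")
proof (rule cring.cring_fieldI2)
  have assoc: "x \<^bold>+ y \<^bold>+ z = x \<^bold>+ (y \<^bold>+ z)" if "x \<in> F" "y \<in> F" "z \<in> F" for x y z
    using that near_assoc[of x y z] d_eq_one by simp
  have comm: "x \<^bold>+ y = y \<^bold>+ x" if "x \<in> F" "y \<in> F" for x y
    using that near_comm[of x y] d_eq_one by simp
  show "cring ?K"
  proof (rule cringI)
    show "abelian_group ?K"
    proof (rule abelian_groupI)
      show "\<exists>y\<in>carrier ?K. y \<oplus>\<^bsub>?K\<^esub> x = \<zero>\<^bsub>?K\<^esub>" if "x \<in> carrier ?K" for x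
        using that add_neg comm[of x "neg x"] by (auto intro!: bexI[of _ "neg x"])
    qed (simp_all add: assoc, (fact comm)?)
    show "comm_monoid ?K"
      by (rule comm_monoidI) (simp_all add: mul_assoc, (fact mul_comm)?)
  qed (simp add: distrib_right)
  show "\<zero>\<^bsub>?K\<^esub> \<noteq> \<one>\<^bsub>?K\<^esub>" using one_not_zero by auto
  show "\<exists>b\<in>carrier ?K. a \<otimes>\<^bsub>?K\<^esub> b = \<one>\<^bsub>?K\<^esub>" if "a \<in> carrier ?K" "a \<noteq> \<zero>\<^bsub>?K\<^esub>" for a
  proof -
    have "a \<in> F" "a \<noteq> \<^bold>0" using that by simp_all
    then obtain b where "b \<in> F" "b \<^bold>* a = \<^bold>1" using inverse_ex by blast
    then show ?thesis using mul_comm \<open>a \<in> F\<close> by (intro bexI[of _ b]) simp_all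
  qed
qed

end

section \<open>Permutation groups and sharply 2-transitive groups\<close>

locale perm_group_on =
  fixes \<Omega> :: "'a set" and G :: "('a \<Rightarrow> 'a) set"
  assumes subgroup_Bij: "subgroup G (BijGroup \<Omega>)"
begin

abbreviation P where "P \<equiv> perm_group \<Omega> G"

lemma carrier_P [simp]: "carrier P = G"
  by (simp add: perm_group_def)

lemma group_P: "group P"
  unfolding perm_group_def
  by (rule subgroup.subgroup_is_group[OF subgroup_Bij group_BijGroup])

sublocale P: group P by (rule group_P)

lemma mem_Bij: "g \<in> G \<Longrightarrow> g \<in> Bij \<Omega>"
  using subgroup.subset[OF subgroup_Bij] by (auto simp: BijGroup_def)

lemma closed [simp, intro]: "\<lbrakk>g \<in> G; x \<in> \<Omega>\<rbrakk> \<Longrightarrow> g x \<in> \<Omega>"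
  using mem_Bij Bij_imp_funcset by fastforce

lemma perm_eqI: "\<lbrakk>g \<in> G; h \<in> G; \<And>x. x \<in> \<Omega> \<Longrightarrow> g x = h x\<rbrakk> \<Longrightarrow> g = h"
  using mem_Bij Bij_imp_extensional by (metis extensionalityI)

lemma apply_mult [simp]: "\<lbrakk>g \<in> G; h \<in> G; x \<in> \<Omega>\<rbrakk> \<Longrightarrow> (g \<otimes>\<^bsub>P\<^esub> h) x = g (h x)"
  by (simp add: perm_group_def BijGroup_def mem_Bij compose_def)

lemma apply_one [simp]: "x \<in> \<Omega> \<Longrightarrow> \<one>\<^bsub>P\<^esub> x = x"
  by (simp add: perm_group_def BijGroup_def)

lemma mult_in [simp, intro]: "\<lbrakk>g \<in> G; h \<in> G\<rbrakk> \<Longrightarrow> g \<otimes>\<^bsub>P\<^esub> h \<in> G"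
  using P.m_closed by simp

lemma inv_in [simp, intro]: "g \<in> G \<Longrightarrow> inv\<^bsub>P\<^esub> g \<in> G"
  using P.inv_closed by simp

lemma one_in [simp, intro]: "\<one>\<^bsub>P\<^esub> \<in> G"
  using P.one_closed by simp

lemma apply_inv_left [simp]: "\<lbrakk>g \<in> G; x \<in> \<Omega>\<rbrakk> \<Longrightarrow> (inv\<^bsub>P\<^esub> g) (g x) = x"
  using apply_mult[of "inv\<^bsub>P\<^esub> g" g x] by simp

lemma apply_inv_right [simp]: "\<lbrakk>g \<in> G; x \<in> \<Omega>\<rbrakk> \<Longrightarrow> g ((inv\<^bsub>P\<^esub> g) x) = x"
  using apply_mult[of g "inv\<^bsub>P\<^esub> g" x] by simp

lemma apply_eq_iff: "\<lbrakk>g \<in> G; x \<in> \<Omega>; y \<in> \<Omega>\<rbrakk> \<Longrightarrow> g x = g y \<longleftrightarrow> x = y"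
  by (metis apply_inv_left)

lemma apply_inv_eq: "\<lbrakk>g \<in> G; x \<in> \<Omega>; g x = y\<rbrakk> \<Longrightarrow> (inv\<^bsub>P\<^esub> g) y = x"
  by auto

end

text \<open>The points \<open>p0\<close> and \<open>p1\<close> become the zero and the unit of the field.\<close>
locale two_transitive_abelian = perm_group_on +
  fixes p0 p1 :: 'a
  assumes p0 [simp, intro]: "p0 \<in> \<Omega>" and p1 [simp, intro]: "p1 \<in> \<Omega>" and p1_neq_p0 [simp]: "p1 \<noteq> p0"
    and two_transitive: "\<lbrakk>x \<in> \<Omega>; y \<in> \<Omega>; x \<noteq> y; x' \<in> \<Omega>; y' \<in> \<Omega>; x' \<noteq> y'\<rbrakk>
      \<Longrightarrow> \<exists>g\<in>G. g x = x' \<and> g y = y'"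
    and stabilizer_comm: "\<lbrakk>g \<in> G; h \<in> G; g p0 = p0; h p0 = p0; x \<in> \<Omega>\<rbrakk> \<Longrightarrow> g (h x) = h (g x)"
begin

lemma p0_neq_p1 [simp]: "p0 \<noteq> p1"
  using p1_neq_p0 by (rule not_sym)

text \<open>A transitive abelian group is regular.\<close>
lemma p0_stabilizer_regular:
  assumes "g \<in> G" "g p0 = p0" "x \<in> \<Omega>" "x \<noteq> p0" "g x = x"
  shows "g = \<one>\<^bsub>P\<^esub>"
proof (rule perm_eqI)
  fix y assume y: "y \<in> \<Omega>"
  show "g y = \<one>\<^bsub>P\<^esub> y"
  proof (cases "y = p0")
    case False
    then obtain h where "h \<in> G" "h p0 = p0" "h x = y"
      using two_transitive[of p0 x p0 y] assms y by auto
    then show ?thesis using assms y stabilizer_comm[of g h x] by simp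
  qed (simp add: assms)
qed (use assms in auto)

lemma two_points_fixed:
  assumes "g \<in> G" "x \<in> \<Omega>" "y \<in> \<Omega>" "x \<noteq> y" "g x = x" "g y = y"
  shows "g = \<one>\<^bsub>P\<^esub>"
proof -
  obtain k where k: "k \<in> G" "k p0 = x" "k p1 = y"
    using two_transitive[of p0 p1 x y] assms by auto
  have "inv\<^bsub>P\<^esub> k \<otimes>\<^bsub>P\<^esub> (g \<otimes>\<^bsub>P\<^esub> k) = \<one>\<^bsub>P\<^esub>"
    by (rule p0_stabilizer_regular[of _ p1]) (use assms k apply_inv_eq in auto)
  then have "g \<otimes>\<^bsub>P\<^esub> k = \<one>\<^bsub>P\<^esub> \<otimes>\<^bsub>P\<^esub> k"
    using assms k by (metis P.inv_solve_left' P.l_one P.one_closed P.r_one carrier_P mult_in)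
  then show ?thesis using assms k by (metis P.one_closed P.right_cancel carrier_P)
qed

lemma two_points_agree:
  assumes "g \<in> G" "h \<in> G" "x \<in> \<Omega>" "y \<in> \<Omega>" "x \<noteq> y" "g x = h x" "g y = h y"
  shows "g = h"
proof -
  have "inv\<^bsub>P\<^esub> h \<otimes>\<^bsub>P\<^esub> g = \<one>\<^bsub>P\<^esub>"
    by (rule two_points_fixed[of _ x y]) (use assms in auto)
  then show ?thesis using assms by (metis P.inv_inv P.inv_unique' P.inv_equality carrier_P inv_in)
qed

text \<open>The multiplication by \<open>x\<close>, which has to take the unit to \<open>x\<close>.\<close>
definition scale :: "'a \<Rightarrow> 'a \<Rightarrow> 'a"
  where "scale x = (SOME m. m \<in> G \<and> m p0 = p0 \<and> m p1 = x)"

lemma scale: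
  assumes "x \<in> \<Omega>" "x \<noteq> p0"
  shows "scale x \<in> G" "scale x p0 = p0" "scale x p1 = x"
proof -
  have "\<exists>m. m \<in> G \<and> m p0 = p0 \<and> m p1 = x"
    using two_transitive[of p0 p1 p0 x] assms by auto
  from someI_ex[OF this] show "scale x \<in> G" "scale x p0 = p0" "scale x p1 = x"
    unfolding scale_def by auto
qed

text \<open>By sharp 2-transitivity this is an involution.\<close>
definition flip :: "'a \<Rightarrow> 'a \<Rightarrow> 'a"
  where "flip a = (SOME g. g \<in> G \<and> g p0 = a \<and> g a = p0)"

lemma flip:
  assumes "a \<in> \<Omega>" "a \<noteq> p0"
  shows "flip a \<in> G" "flip a p0 = a" "flip a a = p0"
proof -
  have "\<exists>g. g \<in> G \<and> g p0 = a \<and> g a = p0"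
    using two_transitive[of p0 a a p0] assms by auto
  from someI_ex[OF this] show "flip a \<in> G" "flip a p0 = a" "flip a a = p0"
    unfolding flip_def by auto
qed

lemma flip_flip:
  assumes "a \<in> \<Omega>" "a \<noteq> p0" "x \<in> \<Omega>"
  shows "flip a (flip a x) = x"
proof -
  have "flip a \<otimes>\<^bsub>P\<^esub> flip a = \<one>\<^bsub>P\<^esub>"
    by (rule two_points_fixed[of _ p0 a]) (use flip assms in auto)
  then show ?thesis using assms flip by (metis apply_mult apply_one)
qed

text \<open>The map \<open>x \<mapsto> -x\<close>. In characteristic two the stabilizer of \<open>p0\<close> has no involution, and the
  identity takes its place.\<close>
definition half_turn :: "'a \<Rightarrow> 'a"
  where "half_turn = (if \<exists>m\<in>G. m p0 = p0 \<and> m \<noteq> \<one>\<^bsub>P\<^esub> \<and> m \<otimes>\<^bsub>P\<^esub> m = \<one>\<^bsub>P\<^esub>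
    then SOME m. m \<in> G \<and> m p0 = p0 \<and> m \<noteq> \<one>\<^bsub>P\<^esub> \<and> m \<otimes>\<^bsub>P\<^esub> m = \<one>\<^bsub>P\<^esub> else \<one>\<^bsub>P\<^esub>)"

lemma half_turn_cases:
  obtains "half_turn \<in> G" "half_turn p0 = p0" "half_turn \<noteq> \<one>\<^bsub>P\<^esub>" "half_turn \<otimes>\<^bsub>P\<^esub> half_turn = \<one>\<^bsub>P\<^esub>"
  | "half_turn = \<one>\<^bsub>P\<^esub>" "\<forall>m\<in>G. m p0 = p0 \<and> m \<otimes>\<^bsub>P\<^esub> m = \<one>\<^bsub>P\<^esub> \<longrightarrow> m = \<one>\<^bsub>P\<^esub>"
proof (cases "\<exists>m\<in>G. m p0 = p0 \<and> m \<noteq> \<one>\<^bsub>P\<^esub> \<and> m \<otimes>\<^bsub>P\<^esub> m = \<one>\<^bsub>P\<^esub>")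
  case True
  then have "\<exists>m. m \<in> G \<and> m p0 = p0 \<and> m \<noteq> \<one>\<^bsub>P\<^esub> \<and> m \<otimes>\<^bsub>P\<^esub> m = \<one>\<^bsub>P\<^esub>" by blast
  from someI_ex[OF this]
  have "half_turn \<in> G \<and> half_turn p0 = p0 \<and> half_turn \<noteq> \<one>\<^bsub>P\<^esub> \<and> half_turn \<otimes>\<^bsub>P\<^esub> half_turn = \<one>\<^bsub>P\<^esub>"
    unfolding half_turn_def if_P[OF True] .
  then show thesis by (intro that(1)) simp_all
next
  case False
  then have "half_turn = \<one>\<^bsub>P\<^esub>" unfolding half_turn_def by (rule if_not_P)
  then show thesis using False by (intro that(2)) blast+
qed

lemma half_turn [simp, intro]: "half_turn \<in> G" "half_turn p0 = p0"
  by (metis half_turn_cases one_in, metis half_turn_cases apply_one p0)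

lemma half_turn_half_turn [simp]: "x \<in> \<Omega> \<Longrightarrow> half_turn (half_turn x) = x"
  by (metis half_turn_cases apply_mult apply_one half_turn(1))

text \<open>In an affine group, the map that swaps \<open>0\<close> and \<open>a\<close> by a half-turn is \<open>x \<mapsto> a - x\<close>; composed with
  \<open>x \<mapsto> -x\<close> it is the translation by \<open>a\<close>. This recovers the addition from the group.\<close>
definition translation :: "'a \<Rightarrow> 'a \<Rightarrow> 'a"
  where "translation a = (if a = p0 then \<one>\<^bsub>P\<^esub> else flip a \<otimes>\<^bsub>P\<^esub> half_turn)"

lemma translation [simp, intro]: "a \<in> \<Omega> \<Longrightarrow> translation a \<in> G" "a \<in> \<Omega> \<Longrightarrow> translation a p0 = a"
  using flip by (auto simp: translation_def)

lemma translation_eq: "\<lbrakk>a \<in> \<Omega>; a \<noteq> p0; x \<in> \<Omega>\<rbrakk> \<Longrightarrow> translation a x = flip a (half_turn x)"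
  using flip by (simp add: translation_def)

lemma translation_p0 [simp]: "x \<in> \<Omega> \<Longrightarrow> translation p0 x = x"
  by (simp add: translation_def)

lemma flip_conj:
  assumes "m \<in> G" "m p0 = p0" "a \<in> \<Omega>" "a \<noteq> p0" "x \<in> \<Omega>"
  shows "m (flip a x) = flip (m a) (m x)"
proof -
  have ma: "m a \<in> \<Omega>" "m a \<noteq> p0" using assms apply_eq_iff[of m a p0] by auto
  have "m \<otimes>\<^bsub>P\<^esub> flip a = flip (m a) \<otimes>\<^bsub>P\<^esub> m"
    by (rule two_points_agree[of _ _ p0 a]) (use assms flip ma in auto)
  then show ?thesis using assms flip ma by (metis apply_mult)
qed

lemma translation_conj:
  assumes "m \<in> G" "m p0 = p0" "a \<in> \<Omega>" "x \<in> \<Omega>"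
  shows "m (translation a x) = translation (m a) (m x)"
proof (cases "a = p0")
  case False
  then have ma: "m a \<in> \<Omega>" "m a \<noteq> p0" using assms apply_eq_iff[of m a p0] by auto
  show ?thesis
    using assms ma False flip_conj[of m a "half_turn x"] stabilizer_comm[of m half_turn x] by (simp add: translation_eq)
qed (use assms in auto)

lemma translation_half_turn:
  assumes "a \<in> \<Omega>" "x \<in> \<Omega>"
  shows "translation (half_turn a) (translation a x) = x"
proof (cases "a = p0")
  case False
  then have ma: "half_turn a \<in> \<Omega>" "half_turn a \<noteq> p0" using assms apply_eq_iff[of half_turn a p0] by auto
  show ?thesis
    using assms ma False flip_conj[of half_turn a "half_turn x"] flip by (simp add: translation_eq flip_flip)
qed (use assms in auto)

lemma translation_half_turn': "\<lbrakk>a \<in> \<Omega>; x \<in> \<Omega>\<rbrakk> \<Longrightarrow> translation a (translation (half_turn a) x) = x"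
  using translation_half_turn[of "half_turn a" x] by simp

definition mul :: "'a \<Rightarrow> 'a \<Rightarrow> 'a"
  where "mul x y = (if x = p0 then p0 else scale x y)"

lemma apply_eq_mul:
  assumes "m \<in> G" "m p0 = p0" "x \<in> \<Omega>"
  shows "m x = mul (m p1) x"
proof -
  have m1: "m p1 \<in> \<Omega>" "m p1 \<noteq> p0" using assms apply_eq_iff[of m p1 p0] by auto
  have "m = scale (m p1)"
    by (rule two_points_agree[of _ _ p0 p1]) (use assms scale m1 in auto)
  then show ?thesis using m1 by (simp add: mul_def)
qed

text \<open>Two translations compose to a translation up to an element that fixes \<open>p0\<close>.\<close>
definition defect :: "'a \<Rightarrow> 'a \<Rightarrow> 'a \<Rightarrow> 'a"
  where "defect a b = inv\<^bsub>P\<^esub> (translation (translation a b)) \<otimes>\<^bsub>P\<^esub> (translation a \<otimes>\<^bsub>P\<^esub> translation b)"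

lemma defect_in: "\<lbrakk>a \<in> \<Omega>; b \<in> \<Omega>\<rbrakk> \<Longrightarrow> defect a b \<in> G"
  by (simp add: defect_def)

lemma defect_p0: "\<lbrakk>a \<in> \<Omega>; b \<in> \<Omega>\<rbrakk> \<Longrightarrow> defect a b p0 = p0"
  unfolding defect_def by (simp add: apply_inv_eq)

lemma translation_translation:
  "\<lbrakk>a \<in> \<Omega>; b \<in> \<Omega>; x \<in> \<Omega>\<rbrakk> \<Longrightarrow> translation a (translation b x) = translation (translation a b) (defect a b x)"
  unfolding defect_def by simp

text \<open>Inverting \<open>\<tau>\<^sub>a \<tau>\<^sub>b = \<tau>\<^sub>c D\<close> turns every translation into the one by the negative and reverses the
  order, so conjugation with the half-turn expresses \<open>b + a\<close> through \<open>a + b\<close> and the inverse of \<open>D\<close>.\<close>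
lemma translation_comm_defect:
  assumes "a \<in> \<Omega>" "b \<in> \<Omega>"
  shows "translation a b = defect a b (translation b a)"
proof -
  define c where "c = translation a b"
  have c: "c \<in> \<Omega>" using assms c_def by simp
  \<comment> \<open>Chosen so that the translations by \<open>b\<close> and \<open>a\<close> bring \<open>x\<close> to \<open>p0\<close>.\<close>
  define x where "x = (inv\<^bsub>P\<^esub> defect a b) (half_turn c)"
  have x: "x \<in> \<Omega>" "defect a b x = half_turn c" using c assms defect_in x_def by auto
  have "translation a (translation b x) = translation c (half_turn c)" using translation_translation x assms c_def by simp
  also have "\<dots> = p0" using translation_half_turn'[of c p0] c by simp
  finally have "translation (half_turn b) (translation (half_turn a) p0) = x"
    using assms x translation_half_turn by (metis closed translation(1))
  then have "half_turn (translation b a) = x" using assms by (simp add: translation_conj)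
  then have "half_turn (defect a b (translation b a)) = half_turn c"
    using x assms defect_in defect_p0 stabilizer_comm[of half_turn "defect a b" "translation b a"] by simp
  then show ?thesis using assms c defect_in unfolding c_def by (simp add: apply_eq_iff)
qed

sublocale commutative_near_domain \<Omega> translation mul p0 p1 half_turn "\<lambda>a b. defect a b p1"
proof
  have mul_eq: "mul x y = scale x y" if "x \<in> \<Omega>" "x \<noteq> p0" for x y using that by (simp add: mul_def)
  show mul_closed: "mul x y \<in> \<Omega>" if "x \<in> \<Omega>" "y \<in> \<Omega>" for x y
    using that scale(1) by (auto simp: mul_def)
  have mul_p0: "mul x p0 = p0" if "x \<in> \<Omega>" for x using that scale(2) by (auto simp: mul_def)
  show "mul x p0 = p0" if "x \<in> \<Omega>" for x by (rule mul_p0[OF that])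
  show mul_comm: "mul x y = mul y x" if xy: "x \<in> \<Omega>" "y \<in> \<Omega>" for x y
  proof (cases "x = p0 \<or> y = p0")
    case True
    then show ?thesis using xy mul_p0[of x] mul_p0[of y] by (auto simp: mul_def)
  next
    case False
    have "scale x (scale y p1) = scale y (scale x p1)"
      by (rule stabilizer_comm) (use False xy scale in auto)
    then show ?thesis using False xy scale by (simp add: mul_eq)
  qed
  show "mul (mul x y) z = mul x (mul y z)" if xyz: "x \<in> \<Omega>" "y \<in> \<Omega>" "z \<in> \<Omega>" for x y z
  proof (cases "x = p0 \<or> y = p0")
    case True
    then show ?thesis using xyz scale(2)[of x] by (auto simp: mul_def)
  next
    case False
    have "(scale x \<otimes>\<^bsub>P\<^esub> scale y) z = mul ((scale x \<otimes>\<^bsub>P\<^esub> scale y) p1) z"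
      by (rule apply_eq_mul) (use False xyz scale in auto)
    then show ?thesis using False xyz scale by (simp add: mul_eq)
  qed
  show "mul p1 x = x" if "x \<in> \<Omega>" for x
    using that apply_eq_mul[of "\<one>\<^bsub>P\<^esub>" x] by simp
  show "\<exists>y\<in>\<Omega>. mul y x = p1" if x: "x \<in> \<Omega>" "x \<noteq> p0" for x
  proof -
    obtain m where m: "m \<in> G" "m p0 = p0" "m x = p1"
      using two_transitive[of p0 x p0 p1] x by auto
    then show ?thesis using apply_eq_mul[of m x] x by (intro bexI[of _ "m p1"]) auto
  qed
  show "mul x (translation y z) = translation (mul x y) (mul x z)" if "x \<in> \<Omega>" "y \<in> \<Omega>" "z \<in> \<Omega>" for x y z
    using that translation_conj[of "scale x" y z] scale by (auto simp: mul_def)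
  show "defect x y p1 \<noteq> p0" if "x \<in> \<Omega>" "y \<in> \<Omega>" for x y
    using that apply_eq_iff[of "defect x y" p1 p0] defect_in defect_p0 by auto
  show "translation x (translation y z) = translation (translation x y) (mul (defect x y p1) z)"
    if "x \<in> \<Omega>" "y \<in> \<Omega>" "z \<in> \<Omega>" for x y z
    using that translation_translation[of x y z] apply_eq_mul[of "defect x y" z] defect_in defect_p0 by simp
  show "translation x y = mul (defect x y p1) (translation y x)" if "x \<in> \<Omega>" "y \<in> \<Omega>" for x y
    using that translation_comm_defect[of x y] apply_eq_mul[of "defect x y" "translation y x"] defect_in defect_p0
    by simp
  show "x = p1" if w: "w \<in> \<Omega>" "w \<noteq> p0" "half_turn w = w" and x: "x \<in> \<Omega>" "mul x x = p1" for w x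
  proof -
    have "x \<noteq> p0" using x by (auto simp: mul_def)
    have "half_turn = \<one>\<^bsub>P\<^esub>" using p0_stabilizer_regular[of half_turn w] w by simp
    then have noinv: "\<forall>m\<in>G. m p0 = p0 \<and> m \<otimes>\<^bsub>P\<^esub> m = \<one>\<^bsub>P\<^esub> \<longrightarrow> m = \<one>\<^bsub>P\<^esub>"
      using half_turn_cases by metis
    have "scale x \<otimes>\<^bsub>P\<^esub> scale x = \<one>\<^bsub>P\<^esub>"
      by (rule two_points_fixed[of _ p0 p1]) (use x \<open>x \<noteq> p0\<close> scale mul_eq[of x x] in auto)
    then have "scale x = \<one>\<^bsub>P\<^esub>" using noinv scale x \<open>x \<noteq> p0\<close> by blast
    then show ?thesis using scale(3)[of x] x \<open>x \<noteq> p0\<close> by simp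
  qed
qed (simp_all add: translation_half_turn defect_in)

theorem eq_affine_maps: "\<exists>K :: 'a ring. field K \<and> carrier K = \<Omega> \<and> G = affine_maps K"
proof -
  define K :: "'a ring"
    where "K = \<lparr>carrier = \<Omega>, monoid.mult = mul, monoid.one = p1, ring.zero = p0, ring.add = translation\<rparr>"
  have K: "carrier K = \<Omega>" "a \<otimes>\<^bsub>K\<^esub> b = mul a b" "a \<oplus>\<^bsub>K\<^esub> b = translation a b" "\<zero>\<^bsub>K\<^esub> = p0" for a b
    by (simp_all add: K_def)
  interpret K: field K unfolding K_def by (rule near_domain_is_field)
  have units: "Units K = \<Omega> - {p0}" using K.field_Units K by simp
  have "G = affine_maps K"
  proof (intro equalityI subsetI)
    fix g assume g: "g \<in> G"
    define b where "b = g p0"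
    define m where "m = inv\<^bsub>P\<^esub> (translation b) \<otimes>\<^bsub>P\<^esub> g"
    have b: "b \<in> \<Omega>" using g b_def by simp
    have m: "m \<in> G" "m p0 = p0" using g b unfolding m_def by (auto simp: b_def apply_inv_eq)
    have m1: "m p1 \<in> \<Omega>" "m p1 \<noteq> p0" using m apply_eq_iff[of m p1 p0] by auto
    have "g x = translation (mul (m p1) x) b" if x: "x \<in> \<Omega>" for x
    proof -
      have "g x = translation b (m x)" using x b g unfolding m_def by simp
      also have "\<dots> = translation (m x) b" using K.a_comm[of b "m x"] x b m K by simp
      finally show ?thesis using apply_eq_mul m x by simp
    qed
    then have "g = (\<lambda>x\<in>carrier K. (m p1 \<otimes>\<^bsub>K\<^esub> x) \<oplus>\<^bsub>K\<^esub> b)"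
      using mem_Bij[OF g] Bij_imp_extensional by (intro extensionalityI[of _ \<Omega>]) (auto simp: K)
    then show "g \<in> affine_maps K" unfolding affine_maps_def using units m1 b K by blast
  next
    fix g assume "g \<in> affine_maps K"
    then obtain a b where ab: "a \<in> \<Omega>" "a \<noteq> p0" "b \<in> \<Omega>"
      and g: "g = (\<lambda>x\<in>carrier K. (a \<otimes>\<^bsub>K\<^esub> x) \<oplus>\<^bsub>K\<^esub> b)"
      unfolding affine_maps_def using units K by auto
    have "g = translation b \<otimes>\<^bsub>P\<^esub> scale a"
    proof (rule extensionalityI[of _ \<Omega>])
      show "translation b \<otimes>\<^bsub>P\<^esub> scale a \<in> extensional \<Omega>"
        using ab scale by (meson mem_Bij Bij_imp_extensional mult_in translation(1))
      show "g x = (translation b \<otimes>\<^bsub>P\<^esub> scale a) x" if "x \<in> \<Omega>" for x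
        using that ab scale[of a] K.a_comm[of "mul a x" b] by (simp add: g K mul_def)
    qed (simp add: g K)
    then show "g \<in> G" using ab scale by simp
  qed
  then show ?thesis using K.field_axioms K(1) by blast
qed

end

section \<open>Soluble highly transitive groups\<close>

context group
begin

lemma exp_of_derived_incl:
  assumes "subgroup H G"
  shows "(derived G ^^ k) H \<subseteq> H"
  using assms derived_incl by (induct k) (auto simp del: subset_iff)

text \<open>Each derived group of a normal subgroup is normal. The induction runs in \<open>H\<close> as a group of its own,
  because \<open>H\<close> need not be normal in \<open>G\<close>.\<close>
lemma exp_of_derived_conj_closed:
  assumes H: "subgroup H G" and h: "h \<in> H" and a: "a \<in> (derived G ^^ k) H"
  shows "h \<otimes> a \<otimes> inv h \<in> (derived G ^^ k) H"
proof -
  define Q where "Q = G\<lparr>carrier := H\<rparr>"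
  interpret Q: group Q unfolding Q_def by (rule subgroup_imp_group[OF H])
  have eq: "(derived Q ^^ k) H = (derived G ^^ k) H" for k
  proof (induct k)
    case (Suc k)
    then show ?case using derived_consistent[OF exp_of_derived_incl[OF H] H] by (simp add: Q_def)
  qed simp
  have "(derived Q ^^ k) H \<lhd> Q" for k
  proof (induct k)
    case 0
    then show ?case using Q.normal_self by (simp add: Q_def)
  next
    case (Suc k)
    then show ?case using Q.derived_is_normal by simp
  qed
  then have "h \<otimes>\<^bsub>Q\<^esub> a \<otimes>\<^bsub>Q\<^esub> inv\<^bsub>Q\<^esub> h \<in> (derived Q ^^ k) H"
    by (rule normal.inv_op_closed2) (use h a eq in \<open>auto simp: Q_def\<close>)
  then show ?thesis using eq h m_inv_consistent[OF H] by (simp add: Q_def)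
qed

lemma commute_if_derived_trivial:
  assumes "derived G D = {\<one>}" "D \<subseteq> carrier G" "a \<in> D" "b \<in> D"
  shows "a \<otimes> b = b \<otimes> a"
proof -
  have ab: "a \<in> carrier G" "b \<in> carrier G" using assms by auto
  have "a \<otimes> b \<otimes> inv a \<otimes> inv b \<in> derived G D"
    unfolding derived_def by (rule generate.incl) (use assms in auto)
  then have "a \<otimes> b \<otimes> inv a \<otimes> inv b = \<one>" using assms by simp
  then have "a \<otimes> b \<otimes> inv (b \<otimes> a) = \<one>" using ab by (simp add: inv_mult_group m_assoc)
  then show ?thesis using ab by (metis inv_equality inv_inv m_closed inv_closed)
qed

end

lemma multiply_transitiveD:
  assumes "multiply_transitive m \<Omega> G" "length xs = m" "distinct xs" "set xs \<subseteq> \<Omega>"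
    "length ys = m" "distinct ys" "set ys \<subseteq> \<Omega>"
  shows "\<exists>g\<in>G. map g xs = ys"
proof -
  have "\<forall>xs ys. length xs = m \<and> distinct xs \<and> set xs \<subseteq> \<Omega> \<and>
      length ys = m \<and> distinct ys \<and> set ys \<subseteq> \<Omega> \<longrightarrow> (\<exists>g\<in>G. map g xs = ys)"
    using assms(1) unfolding multiply_transitive_def by (rule conjunct2)
  from this[rule_format, of xs ys] show ?thesis using assms by blast
qed

lemma multiply_transitive_pred:
  assumes "multiply_transitive (Suc m) \<Omega> G"
  shows "multiply_transitive m \<Omega> G"
  unfolding multiply_transitive_def
proof (intro conjI allI impI)
  show "infinite \<Omega> \<or> m \<le> card \<Omega>" using assms unfolding multiply_transitive_def by auto
  fix xs ys
  assume a: "length xs = m \<and> distinct xs \<and> set xs \<subseteq> \<Omega> \<and> length ys = m \<and> distinct ys \<and> set ys \<subseteq> \<Omega>"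
  have ex: "\<exists>x\<in>\<Omega>. x \<notin> set zs" if "length zs = m" for zs
  proof (rule ccontr)
    assume "\<not> (\<exists>x\<in>\<Omega>. x \<notin> set zs)"
    then have sub: "\<Omega> \<subseteq> set zs" by auto
    then have "card \<Omega> \<le> m" using card_mono[OF _ sub] card_length[of zs] that by simp
    then show False using assms sub finite_subset[OF sub] unfolding multiply_transitive_def by auto
  qed
  obtain x y where "x \<in> \<Omega>" "x \<notin> set xs" "y \<in> \<Omega>" "y \<notin> set ys"
    using ex[of xs] ex[of ys] a by blast
  then obtain g where "g \<in> G" "map g (x # xs) = y # ys"
    using a multiply_transitiveD[OF assms, of "x # xs" "y # ys"] by auto
  then show "\<exists>g\<in>G. map g xs = ys" by auto
qed

lemma multiply_transitive_mono:
  assumes "multiply_transitive m \<Omega> G" "k \<le> m"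
  shows "multiply_transitive k \<Omega> G"
  using assms(2,1) by (induct rule: dec_induct) (auto dest: multiply_transitive_pred)

context perm_group_on
begin

definition regular_normal :: "('a \<Rightarrow> 'a) set \<Rightarrow> ('a \<Rightarrow> 'a) set \<Rightarrow> 'a set \<Rightarrow> bool"
  where "regular_normal A H Y \<longleftrightarrow> subgroup A P \<and> A \<subseteq> H \<and>
    (\<forall>h\<in>H. \<forall>a\<in>A. h \<otimes>\<^bsub>P\<^esub> a \<otimes>\<^bsub>P\<^esub> inv\<^bsub>P\<^esub> h \<in> A) \<and>
    (\<forall>a\<in>A. \<forall>b\<in>A. a \<otimes>\<^bsub>P\<^esub> b = b \<otimes>\<^bsub>P\<^esub> a) \<and>
    (\<forall>y\<in>Y. \<forall>z\<in>Y. \<exists>a\<in>A. a y = z) \<and> (\<forall>a\<in>A. \<forall>y\<in>Y. a y = y \<longrightarrow> a = \<one>\<^bsub>P\<^esub>)"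

lemma regular_normalD:
  assumes "regular_normal A H Y"
  shows "subgroup A P" "A \<subseteq> H" "\<lbrakk>h \<in> H; a \<in> A\<rbrakk> \<Longrightarrow> h \<otimes>\<^bsub>P\<^esub> a \<otimes>\<^bsub>P\<^esub> inv\<^bsub>P\<^esub> h \<in> A"
    "\<lbrakk>a \<in> A; b \<in> A\<rbrakk> \<Longrightarrow> a \<otimes>\<^bsub>P\<^esub> b = b \<otimes>\<^bsub>P\<^esub> a"
    "\<lbrakk>y \<in> Y; z \<in> Y\<rbrakk> \<Longrightarrow> \<exists>a\<in>A. a y = z" "\<lbrakk>a \<in> A; y \<in> Y; a y = y\<rbrakk> \<Longrightarrow> a = \<one>\<^bsub>P\<^esub>"
  using assms unfolding regular_normal_def by (simp_all) metis

text \<open>The action of \<open>H\<close> on \<open>Y\<close> is required to be faithful, so that elements of \<open>H\<close> can be identified by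
  their values on \<open>Y\<close>. In the applications \<open>H\<close> fixes all points outside \<open>Y\<close>.\<close>
definition two_transitive_on :: "('a \<Rightarrow> 'a) set \<Rightarrow> 'a set \<Rightarrow> bool"
  where "two_transitive_on H Y \<longleftrightarrow> subgroup H P \<and> Y \<subseteq> \<Omega> \<and>
    (\<forall>h\<in>H. \<forall>y\<in>Y. h y \<in> Y) \<and> (\<forall>h\<in>H. (\<forall>y\<in>Y. h y = y) \<longrightarrow> h = \<one>\<^bsub>P\<^esub>) \<and>
    (\<forall>y\<in>Y. \<forall>z\<in>Y. \<forall>y'\<in>Y. \<forall>z'\<in>Y. y \<noteq> z \<and> y' \<noteq> z' \<longrightarrow> (\<exists>h\<in>H. h y = y' \<and> h z = z'))"

lemma two_transitive_onD:
  assumes "two_transitive_on H Y"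
  shows "\<lbrakk>y \<in> Y; z \<in> Y; y' \<in> Y; z' \<in> Y; y \<noteq> z; y' \<noteq> z'\<rbrakk> \<Longrightarrow> \<exists>h\<in>H. h y = y' \<and> h z = z'"
  using assms unfolding two_transitive_on_def by simp

text \<open>A non-trivial element moves some \<open>y\<close> to some \<open>z \<noteq> y\<close>, and conjugation by \<open>H\<close> carries the pair
  \<open>(y, z)\<close> to any other, so \<open>A\<close> is transitive. Being abelian it is then regular.\<close>
lemma regular_normal_if_abelian:
  assumes H: "two_transitive_on H Y"
    and A: "subgroup A P" "A \<subseteq> H" "A \<noteq> {\<one>\<^bsub>P\<^esub>}"
    and normal: "\<And>h a. \<lbrakk>h \<in> H; a \<in> A\<rbrakk> \<Longrightarrow> h \<otimes>\<^bsub>P\<^esub> a \<otimes>\<^bsub>P\<^esub> inv\<^bsub>P\<^esub> h \<in> A"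
    and abelian: "\<And>a b. \<lbrakk>a \<in> A; b \<in> A\<rbrakk> \<Longrightarrow> a \<otimes>\<^bsub>P\<^esub> b = b \<otimes>\<^bsub>P\<^esub> a"
  shows "regular_normal A H Y"
proof -
  have HG: "H \<subseteq> G" using H subgroup.subset unfolding two_transitive_on_def by fastforce
  have YO: "Y \<subseteq> \<Omega>" using H unfolding two_transitive_on_def by simp
  have oneA: "\<one>\<^bsub>P\<^esub> \<in> A" using A(1) by (rule subgroup.one_closed)
  then obtain a where a: "a \<in> A" "a \<noteq> \<one>\<^bsub>P\<^esub>" using A(3) by auto
  then obtain y0 where y0: "y0 \<in> Y" "a y0 \<noteq> y0" using H A(2) unfolding two_transitive_on_def by blast
  have ay0: "a y0 \<in> Y" using H A(2) a y0 unfolding two_transitive_on_def by blast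
  have aG: "a \<in> G" using a A HG by auto
  have transitive: "\<exists>b\<in>A. b y = z" if yz: "y \<in> Y" "z \<in> Y" for y z
  proof (cases "y = z")
    case True
    then show ?thesis using oneA yz YO by (intro bexI[of _ "\<one>\<^bsub>P\<^esub>"]) auto
  next
    case False
    then obtain h where h: "h \<in> H" "h y0 = y" "h (a y0) = z"
      using H y0 ay0 yz unfolding two_transitive_on_def by metis
    have "(inv\<^bsub>P\<^esub> h) y = y0" using h HG y0 YO by (intro apply_inv_eq) auto
    then have "(h \<otimes>\<^bsub>P\<^esub> a \<otimes>\<^bsub>P\<^esub> inv\<^bsub>P\<^esub> h) y = z" using h HG aG yz YO y0 by (simp add: subset_iff)
    then show ?thesis using normal[OF h(1) a(1)] by blast
  qed
  have "b = \<one>\<^bsub>P\<^esub>" if b: "b \<in> A" "y \<in> Y" "b y = y" for b y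
  proof -
    have "b z = z" if z: "z \<in> Y" for z
    proof -
      obtain c where c: "c \<in> A" "c y = z" using transitive b z by blast
      have "(b \<otimes>\<^bsub>P\<^esub> c) y = (c \<otimes>\<^bsub>P\<^esub> b) y" using abelian b c by simp
      moreover have "b \<in> G" "c \<in> G" using A b c HG by auto
      ultimately show ?thesis using b c YO by (simp add: subset_iff)
    qed
    then show ?thesis using H A b unfolding two_transitive_on_def by blast
  qed
  then show ?thesis unfolding regular_normal_def using A normal abelian transitive by blast
qed

text \<open>The \<open>m\<close>-th derived group of the stabilizer lies both in the stabilizer and in the \<open>m\<close>-th derived
  group of \<open>H\<close>. The latter is abelian, hence trivial or regular; either way the two have trivial
  intersection.\<close>
lemma derived_length_stabilizer:
  assumes H: "two_transitive_on H Y" and sol: "(derived P ^^ Suc m) H = {\<one>\<^bsub>P\<^esub>}" and y: "y \<in> Y"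
  shows "(derived P ^^ m) {h \<in> H. h y = y} = {\<one>\<^bsub>P\<^esub>}"
proof -
  have sH: "subgroup H P" and YO: "Y \<subseteq> \<Omega>" using H unfolding two_transitive_on_def by auto
  define S where "S = {h \<in> H. h y = y}"
  define A where "A = (derived P ^^ m) H"
  have HG: "H \<subseteq> G" using subgroup.subset[OF sH] by simp
  have S: "subgroup S P"
  proof (rule P.subgroupI)
    show "S \<noteq> {}" using subgroup.one_closed[OF sH] y YO apply_one[of y] unfolding S_def by blast
    show "inv\<^bsub>P\<^esub> a \<in> S" if "a \<in> S" for a
      using that subgroup.m_inv_closed[OF sH] HG y YO unfolding S_def by (auto intro: apply_inv_eq)
    show "a \<otimes>\<^bsub>P\<^esub> b \<in> S" if "a \<in> S" "b \<in> S" for a b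
      using that subgroup.m_closed[OF sH] HG y YO unfolding S_def by (auto simp: subset_iff)
  qed (use HG S_def in auto)
  have A: "subgroup A P" "A \<subseteq> H"
    unfolding A_def using P.exp_of_derived_is_subgroup[OF sH] P.exp_of_derived_incl[OF sH] by auto
  have "derived P A = {\<one>\<^bsub>P\<^esub>}" using sol unfolding A_def by simp
  then have abelian: "a \<otimes>\<^bsub>P\<^esub> b = b \<otimes>\<^bsub>P\<^esub> a" if "a \<in> A" "b \<in> A" for a b
    using P.commute_if_derived_trivial[of A a b] that A HG by auto
  have sub: "(derived P ^^ m) S \<subseteq> A \<inter> S"
    unfolding A_def using P.mono_exp_of_derived[of S H m] P.exp_of_derived_incl[OF S] S_def by auto
  have "A \<inter> S \<subseteq> {\<one>\<^bsub>P\<^esub>}"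
  proof (cases "A = {\<one>\<^bsub>P\<^esub>}")
    case False
    then have "regular_normal A H Y"
      using regular_normal_if_abelian[OF H A] abelian P.exp_of_derived_conj_closed[OF sH]
      unfolding A_def by blast
    then show ?thesis unfolding regular_normal_def S_def using y by blast
  qed auto
  then have "(derived P ^^ m) S \<subseteq> {\<one>\<^bsub>P\<^esub>}" using sub by blast
  moreover have "\<one>\<^bsub>P\<^esub> \<in> (derived P ^^ m) S"
    using P.exp_of_derived_is_subgroup[OF S] by (rule subgroup.one_closed)
  ultimately show ?thesis unfolding S_def by blast
qed

lemma regular_normal_exists:
  assumes H: "two_transitive_on H Y" and sol: "(derived P ^^ m) H = {\<one>\<^bsub>P\<^esub>}" and "H \<noteq> {\<one>\<^bsub>P\<^esub>}"
  shows "\<exists>A. regular_normal A H Y"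
  using sol
proof (induct m)
  case 0
  then show ?case using assms by simp
next
  case (Suc m)
  have sH: "subgroup H P" using H unfolding two_transitive_on_def by auto
  have HG: "H \<subseteq> G" using subgroup.subset[OF sH] by simp
  define A where "A = (derived P ^^ m) H"
  show ?case
  proof (cases "A = {\<one>\<^bsub>P\<^esub>}")
    case False
    have A: "subgroup A P" "A \<subseteq> H"
      unfolding A_def using P.exp_of_derived_is_subgroup[OF sH] P.exp_of_derived_incl[OF sH] by auto
    have "derived P A = {\<one>\<^bsub>P\<^esub>}" using Suc(2) unfolding A_def by simp
    then have abelian: "a \<otimes>\<^bsub>P\<^esub> b = b \<otimes>\<^bsub>P\<^esub> a" if "a \<in> A" "b \<in> A" for a b
      using P.commute_if_derived_trivial[of A a b] that A HG by auto
    have "regular_normal A H Y"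
      using regular_normal_if_abelian[OF H A] abelian P.exp_of_derived_conj_closed[OF sH] False
      unfolding A_def by blast
    then show ?thesis by blast
  qed (use Suc A_def in simp)
qed

definition fixer :: "'a set \<Rightarrow> ('a \<Rightarrow> 'a) set"
  where "fixer S = {g \<in> G. \<forall>x\<in>S. g x = x}"

lemma fixer_subgroup: "S \<subseteq> \<Omega> \<Longrightarrow> subgroup (fixer S) P"
  by (rule P.subgroupI) (auto simp: fixer_def subset_iff apply_inv_eq intro!: exI[of _ "\<one>\<^bsub>P\<^esub>"])

lemma two_transitive_on_fixer:
  assumes S: "S \<subseteq> \<Omega>" "finite S" and mt: "multiply_transitive (card S + 2) \<Omega> G"
  shows "two_transitive_on (fixer S) (\<Omega> - S)"
  unfolding two_transitive_on_def
proof (intro conjI ballI impI)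
  show "subgroup (fixer S) P" by (rule fixer_subgroup[OF S(1)])
  show "h y \<in> \<Omega> - S" if "h \<in> fixer S" "y \<in> \<Omega> - S" for h y
  proof -
    have h: "h \<in> G" "\<forall>x\<in>S. h x = x" using that unfolding fixer_def by simp_all
    have "h y \<notin> S"
    proof
      assume "h y \<in> S"
      then have "h (h y) = h y" using h by blast
      then have "h y = y" using h that by (simp add: apply_eq_iff)
      then show False using \<open>h y \<in> S\<close> that by simp
    qed
    then show ?thesis using h that by simp
  qed
  show "h = \<one>\<^bsub>P\<^esub>" if "h \<in> fixer S" "\<forall>y\<in>\<Omega> - S. h y = y" for h
    using that by (intro perm_eqI) (auto simp: fixer_def)
  fix y z y' z'
  assume y: "y \<in> \<Omega> - S" "z \<in> \<Omega> - S" "y' \<in> \<Omega> - S" "z' \<in> \<Omega> - S" "y \<noteq> z \<and> y' \<noteq> z'"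
  obtain xs where xs: "set xs = S" "distinct xs" using finite_distinct_list[OF S(2)] by blast
  then have len: "length xs = card S" using distinct_card by metis
  have "\<exists>g\<in>G. map g (y # z # xs) = y' # z' # xs"
  proof (rule multiply_transitiveD[OF mt])
    show "length (y # z # xs) = card S + 2" "length (y' # z' # xs) = card S + 2" using len by simp_all
    show "distinct (y # z # xs)" "distinct (y' # z' # xs)" using y xs by simp_all
    show "set (y # z # xs) \<subseteq> \<Omega>" "set (y' # z' # xs) \<subseteq> \<Omega>" using y xs S(1) by simp_all
  qed
  then obtain g where g: "g \<in> G" "map g (y # z # xs) = y' # z' # xs" by (rule bexE)
  have "map g xs = map (\<lambda>x. x) xs" using g(2) by simp
  then have "\<forall>x\<in>S. g x = x" unfolding map_eq_conv xs(1) .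
  then have "g \<in> fixer S" using g(1) by (simp add: fixer_def)
  moreover have "g y = y' \<and> g z = z'" using g(2) by simp
  ultimately show "\<exists>h\<in>fixer S. h y = y' \<and> h z = z'" by blast
qed (rule Diff_subset)

lemma derived_length_fixer_insert:
  assumes S: "S \<subseteq> \<Omega>" "finite S" and mt: "multiply_transitive (card S + 2) \<Omega> G"
    and y: "y \<in> \<Omega> - S" and sol: "(derived P ^^ Suc m) (fixer S) = {\<one>\<^bsub>P\<^esub>}"
  shows "(derived P ^^ m) (fixer (insert y S)) = {\<one>\<^bsub>P\<^esub>}"
proof -
  have "{h \<in> fixer S. h y = y} = fixer (insert y S)" by (auto simp: fixer_def)
  then show ?thesis
    using derived_length_stabilizer[OF two_transitive_on_fixer[OF S mt] sol y] by simp
qed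

lemma fixer_comm:
  assumes "derived P (fixer S) = {\<one>\<^bsub>P\<^esub>}" "g \<in> fixer S" "h \<in> fixer S" "x \<in> \<Omega>"
  shows "g (h x) = h (g x)"
proof -
  have "fixer S \<subseteq> carrier P" by (auto simp: fixer_def)
  then have "g \<otimes>\<^bsub>P\<^esub> h = h \<otimes>\<^bsub>P\<^esub> g" using P.commute_if_derived_trivial assms by blast
  then show ?thesis using assms unfolding fixer_def by (metis (no_types, lifting) apply_mult mem_Collect_eq)
qed

text \<open>An element of a regular group is determined by its value at \<open>y\<close>; so the conjugate of \<open>a\<close> by \<open>h\<close>
  must be \<open>b\<close>.\<close>
lemma regular_normal_conj:
  assumes A: "regular_normal A H Y" and HG: "H \<subseteq> G" "Y \<subseteq> \<Omega>" and y: "y \<in> Y"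
    and h: "h \<in> H" "h y = y" and ab: "a \<in> A" "b \<in> A" "h (a y) = b y" and x: "x \<in> \<Omega>"
  shows "h (a x) = b (h x)"
proof -
  define c where "c = h \<otimes>\<^bsub>P\<^esub> a \<otimes>\<^bsub>P\<^esub> inv\<^bsub>P\<^esub> h"
  note A = regular_normalD[OF A]
  have in_G: "h \<in> G" "a \<in> G" "b \<in> G" using A(2) HG h ab by auto
  have yO: "y \<in> \<Omega>" using y HG by auto
  have c: "c \<in> A" unfolding c_def by (rule A(3)[OF h(1) ab(1)])
  then have bc: "inv\<^bsub>P\<^esub> b \<otimes>\<^bsub>P\<^esub> c \<in> A"
    by (intro subgroup.m_closed[OF A(1)] subgroup.m_inv_closed[OF A(1)] ab)
  have cG: "c \<in> G" using in_G c_def by simp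
  have "c y = b y" using in_G h ab yO apply_inv_eq[of h y y] unfolding c_def by simp
  then have "(inv\<^bsub>P\<^esub> b \<otimes>\<^bsub>P\<^esub> c) y = y" using in_G yO cG by simp
  then have "inv\<^bsub>P\<^esub> b \<otimes>\<^bsub>P\<^esub> c = \<one>\<^bsub>P\<^esub>" by (rule A(6)[OF bc y])
  then have "(inv\<^bsub>P\<^esub> b \<otimes>\<^bsub>P\<^esub> c) (h x) = h x" using in_G x by simp
  then have "c (h x) = b (h x)" using in_G x cG by (metis apply_inv_right apply_mult closed inv_in)
  then show ?thesis using in_G x unfolding c_def by simp
qed

end

text \<open>With \<open>q\<close> as base point, \<open>a \<mapsto> a q\<close> identifies \<open>A\<close> with the points other than \<open>p\<close>, and the
  permutations fixing \<open>p\<close> and \<open>q\<close> act as automorphisms of the abelian group \<open>A\<close>.\<close>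
locale soluble_four_transitive = perm_group_on +
  fixes p q :: 'a and A
  assumes pq: "p \<in> \<Omega>" "q \<in> \<Omega>" "p \<noteq> q"
    and four: "multiply_transitive 4 \<Omega> G"
    and A: "regular_normal A (fixer {p}) (\<Omega> - {p})"
begin

lemma A_in [simp, intro]: "a \<in> A \<Longrightarrow> a \<in> G" and A_p [simp]: "a \<in> A \<Longrightarrow> a p = p"
  using regular_normalD(2)[OF A] by (auto simp: fixer_def)

lemma A_comm:
  assumes "a \<in> A" "b \<in> A" "x \<in> \<Omega>"
  shows "a (b x) = b (a x)"
proof -
  have "(a \<otimes>\<^bsub>P\<^esub> b) x = (b \<otimes>\<^bsub>P\<^esub> a) x" using regular_normalD(4)[OF A assms(1,2)] by simp
  then show ?thesis using assms by simp
qed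

lemma A_ex: "\<lbrakk>x \<in> \<Omega>; x \<noteq> p\<rbrakk> \<Longrightarrow> \<exists>a\<in>A. a q = x"
  using regular_normalD(5)[OF A, of q x] pq by simp

lemma A_semiregular: "\<lbrakk>a \<in> A; x \<in> \<Omega>; x \<noteq> p; a x = x; y \<in> \<Omega>\<rbrakk> \<Longrightarrow> a y = y"
  using regular_normalD(6)[OF A, of a x] by simp

lemma A_mult: "\<lbrakk>a \<in> A; b \<in> A\<rbrakk> \<Longrightarrow> a \<otimes>\<^bsub>P\<^esub> b \<in> A"
  by (rule subgroup.m_closed[OF regular_normalD(1)[OF A]])

lemma conj:
  assumes "h \<in> G" "h p = p" "h q = q" "a \<in> A" "b \<in> A" "h (a q) = b q" "x \<in> \<Omega>"
  shows "h (a x) = b (h x)"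
  using regular_normal_conj[OF A, of q h a b x] assms pq by (auto simp: fixer_def)

text \<open>An automorphism that fixes \<open>a\<close> fixes its inverse. If the two differ, 4-transitivity leaves no room
  for a point other than \<open>p\<close>, \<open>1\<close>, \<open>a\<close> and the inverse of \<open>a\<close>.\<close>
lemma small_if_not_exponent_two:
  assumes a: "a \<in> A" "a (a q) \<noteq> q"
  shows "\<exists>z w. \<Omega> \<subseteq> {p, q, z, w}"
proof -
  define z where "z = a q"
  define w where "w = (inv\<^bsub>P\<^esub> a) q"
  have zw: "z \<in> \<Omega>" "w \<in> \<Omega>" "a w = q" using a pq unfolding z_def w_def by auto
  have ne: "z \<noteq> p" "z \<noteq> q" "w \<noteq> p" "w \<noteq> q" "z \<noteq> w"
    using a pq zw apply_eq_iff[of a q p] unfolding z_def by auto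
  have "v \<in> {p, q, z, w}" if v: "v \<in> \<Omega>" for v
  proof (rule ccontr)
    assume "v \<notin> {p, q, z, w}"
    then have "\<exists>h\<in>G. map h [p, q, z, w] = [p, q, z, v]"
      by (intro multiply_transitiveD[OF four]) (use zw ne pq v in auto)
    then obtain h where h: "h \<in> G" "map h [p, q, z, w] = [p, q, z, v]" by (rule bexE)
    then have hh: "h p = p" "h q = q" "h z = z" "h w = v" by simp_all
    then have "h (a w) = a (h w)" using conj[of h a a w] a zw h(1) unfolding z_def by metis
    then have "a v = a w" using hh zw by metis
    then show False using \<open>v \<notin> {p, q, z, w}\<close> a v zw by (auto simp: apply_eq_iff)
  qed
  then show ?thesis by blast
qed

lemma exponent_two:
  assumes "a \<in> A" "a (a q) = q" "x \<in> \<Omega>"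
  shows "a (a x) = x"
  using A_semiregular[of "a \<otimes>\<^bsub>P\<^esub> a" q x] A_mult assms pq by simp

text \<open>In an elementary abelian 2-group, \<open>1\<close>, \<open>a\<close>, \<open>b\<close> and \<open>a b\<close> are distinct as soon as the first three are.\<close>
lemma fourth_point:
  assumes a: "a \<in> A" "a (a q) = q" "a q \<noteq> q" and w: "w \<in> \<Omega>" "w \<notin> {p, q, a q}"
  shows "a w \<in> \<Omega>" "a w \<notin> {p, q, a q, w}"
proof -
  have "a w \<noteq> w" using w a A_semiregular[of a w q] pq by auto
  moreover have "a w \<noteq> p" using a w apply_eq_iff[of a w p] pq by auto
  moreover have "a w \<noteq> q" using a w apply_eq_iff[of a w "a q"] pq by auto
  moreover have "a w \<noteq> a q" using a w apply_eq_iff[of a w q] pq by auto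
  ultimately show "a w \<notin> {p, q, a q, w}" by simp
qed (use a w in simp)

text \<open>An automorphism that fixes \<open>a\<close> and \<open>b\<close> fixes \<open>a b\<close>.\<close>
lemma small_if_five_transitive:
  assumes five: "multiply_transitive 5 \<Omega> G" and exp2: "\<forall>a\<in>A. a (a q) = q"
  shows "\<exists>z w v. \<Omega> \<subseteq> {p, q, z, w, v}"
proof (rule ccontr)
  assume not: "\<nexists>z w v. \<Omega> \<subseteq> {p, q, z, w, v}"
  then obtain z where z: "z \<in> \<Omega>" "z \<notin> {p, q}" by blast
  then obtain a where a: "a \<in> A" "a q = z" using A_ex by auto
  obtain w where w: "w \<in> \<Omega>" "w \<notin> {p, q, z}" using not by blast
  have v: "a w \<in> \<Omega>" "a w \<notin> {p, q, z, w}" using fourth_point[of a w] a exp2 w z by auto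
  obtain v' where v': "v' \<in> \<Omega>" "v' \<notin> {p, q, z, w, a w}" using not by blast
  have "\<exists>h\<in>G. map h [p, q, z, w, a w] = [p, q, z, w, v']"
    by (rule multiply_transitiveD[OF five]) (use z w v v' pq in auto)
  then obtain h where h: "h \<in> G" "map h [p, q, z, w, a w] = [p, q, z, w, v']" by (rule bexE)
  then have hh: "h p = p" "h q = q" "h z = z" "h w = w" "h (a w) = v'" by simp_all
  then have "h (a w) = a (h w)" using conj[of h a a w] a w h(1) by metis
  then show False using hh v' by simp
qed

text \<open>Write \<open>A\<close> additively and let \<open>C\<close> be the abelian group of permutations that fix \<open>p\<close>, \<open>0\<close> and \<open>a\<close>. It is
  transitive on the remaining points and commutes with \<open>v \<mapsto> a + v\<close>, so some \<open>t\<close> in \<open>C\<close> agrees with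
  this map off \<open>{0, a}\<close>. But \<open>t\<close> is additive: for \<open>v\<close>, \<open>w\<close> and \<open>v + w\<close> outside \<open>{0, a}\<close> this gives
  \<open>a + v + w = (a + v) + (a + w) = v + w\<close>, which is absurd. Hence no such \<open>v\<close> and \<open>w\<close> exist and \<open>A\<close> has at most
  four elements.\<close>
lemma small_if_triple_fixer_abelian:
  assumes abelian: "\<And>z. z \<in> \<Omega> - {p, q} \<Longrightarrow> derived P (fixer {p, q, z}) = {\<one>\<^bsub>P\<^esub>}"
    and exp2: "\<forall>a\<in>A. a (a q) = q"
  shows "\<exists>z w v. \<Omega> \<subseteq> {p, q, z, w, v}"
proof (rule ccontr)
  assume not: "\<nexists>z w v. \<Omega> \<subseteq> {p, q, z, w, v}"
  then obtain z where z: "z \<in> \<Omega>" "z \<notin> {p, q}" by blast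
  then obtain a where a: "a \<in> A" "a q = z" using A_ex by auto
  obtain w where w: "w \<in> \<Omega>" "w \<notin> {p, q, z}" using not by blast
  then obtain b where b: "b \<in> A" "b q = w" using A_ex by auto
  have v: "a w \<in> \<Omega>" "a w \<notin> {p, q, z, w}" using fourth_point[of a w] a exp2 w z by auto
  obtain w' where w': "w' \<in> \<Omega>" "w' \<notin> {p, q, z, w, a w}" using not by blast
  have "\<exists>t\<in>G. map t [p, q, z, w] = [p, q, z, a w]"
    by (rule multiply_transitiveD[OF four]) (use z w v pq in auto)
  then obtain t where t: "t \<in> G" "map t [p, q, z, w] = [p, q, z, a w]" by (rule bexE)
  \<comment> \<open>Both \<open>t\<close> and \<open>a\<close> commute with the fixer of \<open>p\<close>, \<open>q\<close> and \<open>z\<close>, which moves \<open>w\<close> to any such \<open>u\<close>.\<close>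
  have t_eq_a: "t u = a u" if u: "u \<in> \<Omega>" "u \<notin> {p, q, z}" for u
  proof -
    have "\<exists>c\<in>G. map c [p, q, z, w] = [p, q, z, u]"
      by (rule multiply_transitiveD[OF four]) (use z w u pq in auto)
    then obtain c where c: "c \<in> G" "map c [p, q, z, w] = [p, q, z, u]" by (rule bexE)
    have "t (c w) = c (t w)"
      by (rule fixer_comm[OF abelian[of z]]) (use z w t c in \<open>auto simp: fixer_def\<close>)
    also have "\<dots> = a (c w)" using conj[of c a a w] a c t w by simp
    finally show ?thesis using c by simp
  qed
  have bb: "b (b x) = x" and aa: "a (a x) = x" if "x \<in> \<Omega>" for x
    using exponent_two exp2 a b that by auto
  \<comment> \<open>The sum of the elements of \<open>A\<close> that belong to \<open>w\<close> and \<open>w'\<close>.\<close>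
  define r where "r = b w'"
  have r: "r \<in> \<Omega>" unfolding r_def using b w' by simp
  have r_ne: "r \<notin> {p, q, z}"
  proof -
    have "r \<noteq> p" unfolding r_def using b w' pq apply_eq_iff[of b w' p] by auto
    moreover have "w' = w" if "r = q" using that bb w' b unfolding r_def by metis
    moreover have "w' = a w" if "r = z"
      using that bb[of w'] w' b a A_comm[of a b q] pq unfolding r_def by metis
    ultimately show ?thesis using w' by auto
  qed
  \<comment> \<open>Here \<open>t\<close> is used as an automorphism of \<open>A\<close>; it takes \<open>b\<close> to the product of \<open>a\<close> and \<open>b\<close>.\<close>
  have "t (b w') = (a \<otimes>\<^bsub>P\<^esub> b) (t w')"
    using conj[of t b "a \<otimes>\<^bsub>P\<^esub> b" w'] A_mult a b t w' pq by simp
  then have "a r = a (b (a w'))" using t_eq_a r r_ne t_eq_a[of w'] w' a b unfolding r_def by simp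
  then have "r = b (a w')" using a b r w' by (simp add: apply_eq_iff)
  then have "r = a r" using A_comm a b w' unfolding r_def by simp
  then have "a q = q" using A_semiregular[of a r q] a r r_ne pq by simp
  then show False using a z by simp
qed

end

context perm_group_on
begin

lemma card_le_five:
  assumes n: "n \<ge> 3" and mt: "multiply_transitive (n + 1) \<Omega> G" and p: "p \<in> \<Omega>"
    and sol: "(derived P ^^ n) (fixer {p}) = {\<one>\<^bsub>P\<^esub>}"
  shows "finite \<Omega> \<and> card \<Omega> \<le> 5"
proof -
  note mono = multiply_transitive_mono[OF mt]
  have mt4: "multiply_transitive 4 \<Omega> G" and mt3: "multiply_transitive 3 \<Omega> G" by (rule mono, use n in simp)+
  have four_points: "infinite \<Omega> \<or> 4 \<le> card \<Omega>" using mt4 unfolding multiply_transitive_def by simp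
  have ex: "\<exists>x\<in>\<Omega>. x \<notin> S" if "finite S" "card S < 4" for S
    using that four_points by (metis card_mono finite_subset not_less order_trans subsetI leD)
  obtain q where q: "q \<in> \<Omega>" "q \<noteq> p" using ex[of "{p}"] by auto
  obtain z where z: "z \<in> \<Omega>" "z \<noteq> p" "z \<noteq> q" using ex[of "{p, q}"] q by auto
  have H: "two_transitive_on (fixer {p}) (\<Omega> - {p})"
    by (rule two_transitive_on_fixer) (use mt3 p in \<open>simp_all add: numeral_eq_Suc\<close>)
  have "\<exists>h\<in>fixer {p}. h q = z \<and> h z = q" by (rule two_transitive_onD[OF H]) (use q z in simp_all)
  then obtain h where "h \<in> fixer {p}" "h q = z" by (elim bexE conjE)
  then have "fixer {p} \<noteq> {\<one>\<^bsub>P\<^esub>}" using q z by (metis apply_one singletonD)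
  from regular_normal_exists[OF H sol this]
  obtain A where A: "regular_normal A (fixer {p}) (\<Omega> - {p})" by (elim exE)
  interpret soluble_four_transitive \<Omega> G p q A
    by unfold_locales (use p q mt4 A in auto)
  have "\<exists>x y z. \<Omega> \<subseteq> {p, q, x, y, z}"
  proof (cases "\<forall>a\<in>A. a (a q) = q")
    case False
    then obtain x y where "\<Omega> \<subseteq> {p, q, x, y}" using small_if_not_exponent_two by blast
    then have "\<Omega> \<subseteq> {p, q, x, y, y}" by simp
    then show ?thesis by blast
  next
    case True
    show ?thesis
    proof (cases "n \<ge> 4")
      case n4: True
      have "multiply_transitive 5 \<Omega> G" by (rule mono) (use n4 in simp)
      then show ?thesis using small_if_five_transitive True by blast
    next
      case False
      then have n3: "n = 3" using n by simp
      have mt_p: "multiply_transitive (card {p} + 2) \<Omega> G"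
        and mt_qp: "multiply_transitive (card {q, p} + 2) \<Omega> G"
        using mt3 mt4 q by (simp_all add: numeral_eq_Suc)
      \<comment> \<open>Two further fixed points leave derived length one, so the fixer of three points is abelian.\<close>
      have sol2: "(derived P ^^ Suc 1) (fixer {q, p}) = {\<one>\<^bsub>P\<^esub>}"
        by (rule derived_length_fixer_insert[OF _ _ mt_p]) (use p q sol n3 in \<open>simp_all add: numeral_3_eq_3\<close>)
      have "(derived P ^^ 1) (fixer {z, q, p}) = {\<one>\<^bsub>P\<^esub>}" if "z \<in> \<Omega> - {p, q}" for z
        by (rule derived_length_fixer_insert[OF _ _ mt_qp _ sol2]) (use p q that in simp_all)
      moreover have "{z, q, p} = {p, q, z}" for z by auto
      ultimately have "derived P (fixer {p, q, z}) = {\<one>\<^bsub>P\<^esub>}" if "z \<in> \<Omega> - {p, q}" for z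
        using that by simp
      then show ?thesis using small_if_triple_fixer_abelian True by blast
    qed
  qed
  then obtain x y z where sub: "\<Omega> \<subseteq> {p, q, x, y, z}" by blast
  have "card {p, q, x, y, z} \<le> 5" using card_length[of "[p, q, x, y, z]"] by simp
  then show ?thesis using sub by (meson card_mono finite.emptyI finite.insertI finite_subset order_trans)
qed

text \<open>A permutation of \<open>\<Omega>\<close> is determined by its values at all points but one.\<close>
lemma eq_Bij_if_highly_transitive:
  assumes fin: "finite \<Omega>" and card: "card \<Omega> \<le> Suc m" and mt: "multiply_transitive m \<Omega> G"
  shows "G = Bij \<Omega>"
proof (intro equalityI subsetI)
  fix s assume s: "s \<in> Bij \<Omega>"
  then have bij: "bij_betw s \<Omega> \<Omega>" and ext: "s \<in> extensional \<Omega>" by (auto simp: Bij_def)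
  have "m \<le> card \<Omega>" using mt fin unfolding multiply_transitive_def by simp
  then obtain S where S: "S \<subseteq> \<Omega>" "card S = m" by (meson obtain_subset_with_card_n)
  obtain xs where xs: "set xs = S" "distinct xs"
    using finite_distinct_list finite_subset[OF S(1) fin] by blast
  have len: "length xs = m" using xs S distinct_card by metis
  have inj: "inj_on s \<Omega>" using bij by (rule bij_betw_imp_inj_on)
  have "\<exists>g\<in>G. map g xs = map s xs"
  proof (rule multiply_transitiveD[OF mt])
    show "distinct (map s xs)" using xs S inj by (simp add: distinct_map inj_on_subset)
    show "set (map s xs) \<subseteq> \<Omega>" using xs S bij by (auto simp: bij_betw_def)
  qed (use len xs S in auto)
  then obtain g where g: "g \<in> G" "map g xs = map s xs" by (rule bexE)
  have gS: "g x = s x" if "x \<in> S" for x using g xs that by (metis map_eq_conv)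
  have bg: "bij_betw g \<Omega> \<Omega>" using mem_Bij g by (auto simp: Bij_def)
  have "g x = s x" if x: "x \<in> \<Omega>" "x \<notin> S" for x
  proof -
    have "card (\<Omega> - S) \<le> 1" using card_Diff_subset[OF finite_subset[OF S(1) fin] S(1)] S card by simp
    then have O: "\<Omega> = insert x S" using x S fin by (force simp: card_le_Suc0_iff_eq)
    have "g x \<in> s ` \<Omega>" using g(1) x bij by (simp add: bij_betw_def)
    moreover have "g x \<notin> g ` S"
      using x S bij_betw_imp_inj_on[OF bg] by (auto simp: inj_on_def)
    moreover have "g ` S = s ` S" using gS by (rule image_cong[OF HOL.refl])
    ultimately show ?thesis unfolding O by (simp only: image_insert insert_iff) blast
  qed
  then have "g x = s x" if "x \<in> \<Omega>" for x using gS that by blast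
  then have "g = s" by (rule extensionalityI[OF Bij_imp_extensional[OF mem_Bij[OF g(1)]] ext])
  then show "s \<in> G" using g by simp
qed (rule mem_Bij)

lemma action_iso_sym_group:
  assumes "finite \<Omega>" "card \<Omega> = k" "G = Bij \<Omega>"
  shows "action_iso P \<Omega> (\<lambda>g. g) (sym_group k) {1..k} (\<lambda>p. p)"
proof -
  obtain f where f: "bij_betw f \<Omega> {1..k}"
    using ex_bij_betw_finite_nat[OF assms(1)] assms(2)
    by (metis bij_betw_iff_card finite_atLeastAtMost card_atLeastAtMost diff_Suc_1 assms(1))
  define f' where "f' = inv_into \<Omega> f"
  have f': "bij_betw f' {1..k} \<Omega>" unfolding f'_def by (rule bij_betw_inv_into[OF f])
  have ff': "f (f' i) = i" if "i \<in> {1..k}" for i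
    using that f unfolding f'_def by (simp add: bij_betw_inv_into_right)
  have f'f: "f' (f x) = x" if "x \<in> \<Omega>" for x
    using that f unfolding f'_def by (simp add: bij_betw_inv_into_left)
  have fk: "f x \<in> {1..k}" if "x \<in> \<Omega>" for x using f that by (meson bij_betwE)
  have f'k: "f' i \<in> \<Omega>" if "i \<in> {1..k}" for i using f' that by (meson bij_betwE)
  define h where "h g = (\<lambda>i. if i \<in> {1..k} then f (g (f' i)) else i)" for g
  define h' where "h' s = (\<lambda>x\<in>\<Omega>. f' (s (f x)))" for s :: "nat \<Rightarrow> nat"
  have h: "h g permutes {1..k}" if "g \<in> G" for g
  proof (rule bij_imp_permutes)
    have "bij_betw g \<Omega> \<Omega>" using that assms by (simp add: Bij_def)
    then have "bij_betw (f \<circ> g \<circ> f') {1..k} {1..k}" using f f' by (meson bij_betw_trans)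
    then show "bij_betw (h g) {1..k} {1..k}"
      by (rule bij_betw_cong[THEN iffD1, rotated]) (simp add: h_def del: atLeastAtMost_iff One_nat_def)
  qed (simp only: h_def if_False)
  have h': "h' s \<in> G" if "s permutes {1..k}" for s
  proof -
    have "bij_betw s {1..k} {1..k}" using that by (rule permutes_imp_bij)
    then have "bij_betw (f' \<circ> s \<circ> f) \<Omega> \<Omega>" using f f' by (meson bij_betw_trans)
    then have "bij_betw (h' s) \<Omega> \<Omega>"
      by (rule bij_betw_cong[THEN iffD1, rotated]) (simp add: h'_def)
    then show ?thesis by (simp add: assms Bij_def h'_def)
  qed
  have "bij_betw h G {s. s permutes {1..k}}"
  proof (rule bij_betwI[of _ _ _ h'])
    show "h' (h g) = g" if "g \<in> G" for g
      by (rule perm_eqI) (use that h h' in \<open>auto simp: h'_def h_def fk f'f simp del: atLeastAtMost_iff One_nat_def\<close>)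
    show "h (h' s) = s" if "s \<in> {s. s permutes {1..k}}" for s
    proof
      fix i
      show "h (h' s) i = s i"
        using that permutes_in_image[of s "{1..k}" i] permutes_not_in[of s "{1..k}" i]
        by (auto simp: h'_def h_def ff' f'k simp del: atLeastAtMost_iff One_nat_def)
    qed
  qed (use h h' in auto)
  moreover have "h (g \<otimes>\<^bsub>P\<^esub> g') = h g \<circ> h g'" if "g \<in> G" "g' \<in> G" for g g'
    using that by (auto simp: h_def fk f'k f'f fun_eq_iff simp del: atLeastAtMost_iff One_nat_def)
  ultimately have "h \<in> iso P (sym_group k)"
    using h by (auto simp: iso_def hom_def sym_group_def)
  moreover have "f (g x) = h g (f x)" if "g \<in> G" "x \<in> \<Omega>" for g x
    using that by (simp add: h_def fk f'f del: atLeastAtMost_iff One_nat_def)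
  ultimately show ?thesis unfolding action_iso_def using f by auto
qed

end

section \<open>Stabilizers of points in 3-transitive groups\<close>

text \<open>Put \<open>y = s x\<close> and \<open>u = s (1 - x)\<close>. The relation at \<open>1/x\<close> involves, up to factors \<open>x\<close> and \<open>y\<close>, the same
  two values and yields \<open>u (y - x) = y (1 + x)\<close> (the fact \<open>key\<close>). Using it at \<open>1 - x\<close> as well gives a second linear
  equation for \<open>u\<close>; eliminating \<open>u\<close> leaves \<open>2 (x y - 1) = 0\<close>. In characteristic two
  the element \<open>t = x y\<close> is fixed by \<open>s\<close>, and \<open>key\<close> at \<open>t\<close> leaves only \<open>t = 1\<close>.\<close>
lemma (in field) eq_inverse_if_unit_relation:
  assumes s_closed: "\<And>x. \<lbrakk>x \<in> carrier R; x \<noteq> \<zero>\<rbrakk> \<Longrightarrow> s x \<in> carrier R"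
    and s_nz: "\<And>x. \<lbrakk>x \<in> carrier R; x \<noteq> \<zero>\<rbrakk> \<Longrightarrow> s x \<noteq> \<zero>"
    and s_mult: "\<And>x y. \<lbrakk>x \<in> carrier R; x \<noteq> \<zero>; y \<in> carrier R; y \<noteq> \<zero>\<rbrakk> \<Longrightarrow> s (x \<otimes> y) = s x \<otimes> s y"
    and s_s: "\<And>x. \<lbrakk>x \<in> carrier R; x \<noteq> \<zero>\<rbrakk> \<Longrightarrow> s (s x) = x"
    and s_rel: "\<And>x. \<lbrakk>x \<in> carrier R; x \<noteq> \<zero>; x \<noteq> \<one>\<rbrakk> \<Longrightarrow> s (\<one> \<ominus> s x) = \<one> \<ominus> s (\<one> \<ominus> x)"
    and x: "x \<in> carrier R" "x \<noteq> \<zero>"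
  shows "s x \<otimes> x = \<one>"
proof -
  have s1: "s \<one> = \<one>"
  proof -
    have "s \<one> \<otimes> s \<one> = s \<one> \<otimes> \<one>" using s_mult[of \<one> \<one>] s_closed[of \<one>] by simp
    then show ?thesis using m_lcancel[of "s \<one>" "s \<one>" \<one>] s_closed[of \<one>] s_nz[of \<one>] by simp
  qed
  have m1: "\<ominus> \<one> \<noteq> \<zero>" by (metis minus_minus minus_zero one_closed one_not_zero)
  have sm1: "s (\<ominus> \<one>) = \<ominus> \<one>"
  proof -
    have c: "s (\<ominus> \<one>) \<in> carrier R" using s_closed m1 by simp
    have "s (\<ominus> \<one>) \<otimes> s (\<ominus> \<one>) = \<one>" using s_mult[of "\<ominus> \<one>" "\<ominus> \<one>"] m1 s1 by (simp add: l_minus)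
    then have "(s (\<ominus> \<one>) \<ominus> \<one>) \<otimes> (s (\<ominus> \<one>) \<oplus> \<one>) = \<zero>" using c by algebra
    then have "s (\<ominus> \<one>) \<ominus> \<one> = \<zero> \<or> s (\<ominus> \<one>) \<oplus> \<one> = \<zero>" using c by (simp add: integral_iff)
    then show ?thesis
    proof
      assume "s (\<ominus> \<one>) \<ominus> \<one> = \<zero>"
      then have "s (\<ominus> \<one>) = \<one>" using c by simp
      then show ?thesis using s_s[of "\<ominus> \<one>"] m1 s1 by simp
    next
      assume "s (\<ominus> \<one>) \<oplus> \<one> = \<zero>"
      then show ?thesis using c by (metis minus_equality one_closed minus_minus a_comm)
    qed
  qed
  have s_minus: "s (\<ominus> x) = \<ominus> s x" if "x \<in> carrier R" "x \<noteq> \<zero>" for x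
    using s_mult[of "\<ominus> \<one>" x] that m1 sm1 s_closed[of x] by (simp add: l_minus)
  have diff_nz: "a \<ominus> b \<noteq> \<zero>" if "a \<in> carrier R" "b \<in> carrier R" "a \<noteq> b" for a b
    using that by simp
  have s_ne1: "s x \<noteq> \<one>" if "x \<in> carrier R" "x \<noteq> \<zero>" "x \<noteq> \<one>" for x
    using s_s[of x] s1 that by auto
  have key: "s (\<one> \<ominus> x) \<otimes> (s x \<ominus> x) = s x \<otimes> (\<one> \<oplus> x)"
    if x: "x \<in> carrier R" "x \<noteq> \<zero>" "x \<noteq> \<one>" for x
  proof -
    define y where "y = s x"
    define u where "u = s (\<one> \<ominus> x)"
    have y: "y \<in> carrier R" "y \<noteq> \<zero>" "y \<noteq> \<one>" "s y = x"
      unfolding y_def using x s_closed s_nz s_ne1 s_s by auto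
    have x1: "\<one> \<ominus> x \<in> carrier R" "\<one> \<ominus> x \<noteq> \<zero>" using x diff_nz[of \<one> x] by auto
    have y1: "\<one> \<ominus> y \<in> carrier R" "\<one> \<ominus> y \<noteq> \<zero>" using y diff_nz[of \<one> y] by auto
    have u: "u \<in> carrier R" unfolding u_def using s_closed x1 by blast
    have su: "s (\<one> \<ominus> y) = \<one> \<ominus> u" unfolding y_def u_def by (rule s_rel[OF x])
    \<comment> \<open>The relation is evaluated at \<open>z = 1/x\<close>, where \<open>1 - z = - (1 - x) / x\<close>.\<close>
    obtain z where z: "z \<in> carrier R" "x \<otimes> z = \<one>"
      using x field_Units Units_r_inv_ex by auto
    have z0: "z \<noteq> \<zero>" "z \<noteq> \<one>" using z x by auto
    define w where "w = s z"
    have w: "w \<in> carrier R" "w \<noteq> \<zero>" "w \<noteq> \<one>" unfolding w_def using z z0 s_closed s_nz s_ne1 by auto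
    have yw: "y \<otimes> w = \<one>" unfolding y_def w_def using s_mult[of x z] x z z0 s1 by simp
    have z1: "\<one> \<ominus> z \<in> carrier R" "\<one> \<ominus> z \<noteq> \<zero>" using z z0 diff_nz[of \<one> z] by auto
    have w1: "\<one> \<ominus> w \<in> carrier R" "\<one> \<ominus> w \<noteq> \<zero>" using w diff_nz[of \<one> w] by auto
    define p where "p = s (\<one> \<ominus> z)"
    have p: "p \<in> carrier R" unfolding p_def using s_closed z1 by blast
    have r: "s (\<one> \<ominus> w) = \<one> \<ominus> p" unfolding w_def p_def by (rule s_rel[OF z(1) z0])
    have "y \<otimes> p = s (x \<otimes> (\<one> \<ominus> z))" unfolding y_def p_def using s_mult x z1 by simp
    also have "x \<otimes> (\<one> \<ominus> z) = \<ominus> (\<one> \<ominus> x)" using x z by algebra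
    finally have yp: "y \<otimes> p = \<ominus> u" using s_minus x1 u_def by simp
    have "x \<otimes> (\<one> \<ominus> p) = s (y \<otimes> (\<one> \<ominus> w))" using s_mult y w1 r by simp
    also have "y \<otimes> (\<one> \<ominus> w) = \<ominus> (\<one> \<ominus> y)" using y w yw by algebra
    finally have xr: "x \<otimes> (\<one> \<ominus> p) = \<ominus> (\<one> \<ominus> u)" using s_minus y1 su by simp
    have "y \<otimes> (x \<otimes> (\<one> \<ominus> p)) = x \<otimes> y \<ominus> x \<otimes> (y \<otimes> p)" using x y p by algebra
    then have "y \<otimes> (\<ominus> (\<one> \<ominus> u)) = x \<otimes> y \<ominus> x \<otimes> (\<ominus> u)" unfolding xr yp .
    then have "y \<otimes> (\<ominus> (\<one> \<ominus> u)) \<ominus> (x \<otimes> y \<ominus> x \<otimes> (\<ominus> u)) = \<zero>" using x y u by simp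
    moreover have "u \<otimes> (y \<ominus> x) \<ominus> y \<otimes> (\<one> \<oplus> x) = y \<otimes> (\<ominus> (\<one> \<ominus> u)) \<ominus> (x \<otimes> y \<ominus> x \<otimes> (\<ominus> u))"
      using x y u by algebra
    ultimately have "u \<otimes> (y \<ominus> x) \<ominus> y \<otimes> (\<one> \<oplus> x) = \<zero>" by (simp only:)
    then have "u \<otimes> (y \<ominus> x) = y \<otimes> (\<one> \<oplus> x)" using x y u by simp
    then show ?thesis unfolding u_def y_def .
  qed
  show ?thesis
  proof (cases "x = \<one>")
    case True
    then show ?thesis using s1 by simp
  next
    case x1: False
    define y where "y = s x"
    define u where "u = s (\<one> \<ominus> x)"
    have y: "y \<in> carrier R" "y \<noteq> \<zero>" unfolding y_def using x s_closed s_nz by auto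
    have x': "\<one> \<ominus> x \<in> carrier R" "\<one> \<ominus> x \<noteq> \<zero>" using x x1 diff_nz[of \<one> x] by auto
    have u: "u \<in> carrier R" unfolding u_def using s_closed x' by blast
    have x'1: "\<one> \<ominus> x \<noteq> \<one>"
    proof
      assume "\<one> \<ominus> x = \<one>"
      moreover have "x = \<one> \<ominus> (\<one> \<ominus> x)" using x by algebra
      ultimately show False using x by (metis r_right_minus_eq one_closed)
    qed
    have xx: "\<one> \<ominus> (\<one> \<ominus> x) = x" using x by algebra
    have e1: "u \<otimes> (y \<ominus> x) = y \<otimes> (\<one> \<oplus> x)" using key[OF x x1] unfolding u_def y_def .
    have e2: "y \<otimes> (u \<ominus> (\<one> \<ominus> x)) = u \<otimes> (\<one> \<oplus> (\<one> \<ominus> x))"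
      using key[OF x' x'1] unfolding xx u_def y_def .
    have e2': "u \<otimes> (y \<ominus> (\<one> \<oplus> (\<one> \<ominus> x))) = y \<otimes> (\<one> \<ominus> x)"
    proof -
      have "u \<otimes> (y \<ominus> (\<one> \<oplus> (\<one> \<ominus> x))) \<ominus> y \<otimes> (\<one> \<ominus> x)
          = y \<otimes> (u \<ominus> (\<one> \<ominus> x)) \<ominus> u \<otimes> (\<one> \<oplus> (\<one> \<ominus> x))"
        using x y u by algebra
      moreover have "y \<otimes> (u \<ominus> (\<one> \<ominus> x)) \<ominus> u \<otimes> (\<one> \<oplus> (\<one> \<ominus> x)) = \<zero>"
        using e2 x y u by simp
      ultimately have "u \<otimes> (y \<ominus> (\<one> \<oplus> (\<one> \<ominus> x))) \<ominus> y \<otimes> (\<one> \<ominus> x) = \<zero>" by (simp only:)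
      then show ?thesis using x y u by simp
    qed
    have "y \<otimes> ((y \<ominus> x) \<otimes> (\<one> \<ominus> x)) = (y \<ominus> x) \<otimes> (u \<otimes> (y \<ominus> (\<one> \<oplus> (\<one> \<ominus> x))))"
      unfolding e2' using x y by algebra
    also have "\<dots> = (u \<otimes> (y \<ominus> x)) \<otimes> (y \<ominus> (\<one> \<oplus> (\<one> \<ominus> x)))" using x y u by algebra
    also have "\<dots> = y \<otimes> ((\<one> \<oplus> x) \<otimes> (y \<ominus> (\<one> \<oplus> (\<one> \<ominus> x))))"
      unfolding e1 using x y by algebra
    finally have "(y \<ominus> x) \<otimes> (\<one> \<ominus> x) = (\<one> \<oplus> x) \<otimes> (y \<ominus> (\<one> \<oplus> (\<one> \<ominus> x)))"
      using x y m_lcancel by simp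
    then have "(\<one> \<oplus> x) \<otimes> (y \<ominus> (\<one> \<oplus> (\<one> \<ominus> x))) \<ominus> (y \<ominus> x) \<otimes> (\<one> \<ominus> x) = \<zero>"
      using x y by simp
    moreover have "(\<one> \<oplus> \<one>) \<otimes> (y \<otimes> x \<ominus> \<one>)
        = (\<one> \<oplus> x) \<otimes> (y \<ominus> (\<one> \<oplus> (\<one> \<ominus> x))) \<ominus> (y \<ominus> x) \<otimes> (\<one> \<ominus> x)"
      using x y by algebra
    ultimately have "(\<one> \<oplus> \<one>) \<otimes> (y \<otimes> x \<ominus> \<one>) = \<zero>" by (simp only:)
    then have "\<one> \<oplus> \<one> = \<zero> \<or> y \<otimes> x \<ominus> \<one> = \<zero>" using x y by (simp add: integral_iff)
    then have "y \<otimes> x = \<one>"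
    proof
      assume two: "\<one> \<oplus> \<one> = \<zero>"
      define t where "t = y \<otimes> x"
      have t: "t \<in> carrier R" "t \<noteq> \<zero>" unfolding t_def using x y by (auto simp: integral_iff)
      have st: "s t = t" unfolding t_def using s_mult[of y x] x y s_s[of x] m_comm y_def by simp
      have "t = \<one>"
      proof (rule ccontr)
        assume "t \<noteq> \<one>"
        then have "s (\<one> \<ominus> t) \<otimes> (t \<ominus> t) = t \<otimes> (\<one> \<oplus> t)" using key[of t] t st by simp
        moreover have "s (\<one> \<ominus> t) \<in> carrier R" using s_closed diff_nz[of \<one> t] t \<open>t \<noteq> \<one>\<close> by auto
        moreover have "s (\<one> \<ominus> t) \<otimes> (t \<ominus> t) = \<zero>"
          using t calculation(2) by algebra
        ultimately have "t \<otimes> (\<one> \<oplus> t) = \<zero>" by (simp only:)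
        then have "\<one> \<oplus> t = \<zero>" using t by (simp add: integral_iff)
        then have "\<one> \<oplus> t = \<one> \<oplus> \<one>" using two by simp
        then show False using t \<open>t \<noteq> \<one>\<close> by simp
      qed
      then show ?thesis using t_def by simp
    next
      assume "y \<otimes> x \<ominus> \<one> = \<zero>"
      then show ?thesis using x y by simp
    qed
    then show ?thesis unfolding y_def .
  qed
qed

context perm_group_on
begin

text \<open>This makes the results on 2-transitive groups applicable to a point stabilizer.\<close>
lemma restrict_fixer_subgroup:
  assumes p: "p \<in> \<Omega>"
  shows "subgroup ((\<lambda>g. restrict g (\<Omega> - {p})) ` fixer {p}) (BijGroup (\<Omega> - {p}))"
    (is "subgroup (?r ` _) ?B")
proof (rule group.subgroupI[OF group_BijGroup])
  have fixer_maps: "g x \<in> \<Omega> - {p}" if "g \<in> fixer {p}" "x \<in> \<Omega> - {p}" for g x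
    using that p apply_eq_iff[of g x p] by (simp add: fixer_def)
  have inv_fixer: "inv\<^bsub>P\<^esub> g \<in> fixer {p}" if "g \<in> fixer {p}" for g
    using that p by (simp add: fixer_def apply_inv_eq)
  have r_Bij: "?r g \<in> Bij (\<Omega> - {p})" if g: "g \<in> fixer {p}" for g
  proof -
    have gG: "g \<in> G" using g by (simp add: fixer_def)
    have "bij_betw (?r g) (\<Omega> - {p}) (\<Omega> - {p})"
    proof (rule bij_betwI[of _ _ _ "?r (inv\<^bsub>P\<^esub> g)"])
      show "?r g \<in> \<Omega> - {p} \<rightarrow> \<Omega> - {p}" "?r (inv\<^bsub>P\<^esub> g) \<in> \<Omega> - {p} \<rightarrow> \<Omega> - {p}"
        using fixer_maps[OF g] fixer_maps[OF inv_fixer[OF g]] by (simp_all add: Pi_iff)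
      show "?r (inv\<^bsub>P\<^esub> g) (?r g x) = x" "?r g (?r (inv\<^bsub>P\<^esub> g) x) = x" if "x \<in> \<Omega> - {p}" for x
        using that gG fixer_maps[OF g that] fixer_maps[OF inv_fixer[OF g] that] by simp_all
    qed
    then show ?thesis by (simp add: Bij_def)
  qed
  have r_mult: "?r g \<otimes>\<^bsub>?B\<^esub> ?r h = ?r (g \<otimes>\<^bsub>P\<^esub> h)" if gh: "g \<in> fixer {p}" "h \<in> fixer {p}" for g h
  proof -
    have gh': "g \<in> G" "h \<in> G" using gh by (simp_all add: fixer_def)
    have "?r g \<otimes>\<^bsub>?B\<^esub> ?r h = compose (\<Omega> - {p}) (?r g) (?r h)"
      using r_Bij gh by (simp add: BijGroup_def)
    also have "\<dots> = ?r (g \<otimes>\<^bsub>P\<^esub> h)"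
    proof (rule extensionalityI[of _ "\<Omega> - {p}"])
      show "compose (\<Omega> - {p}) (?r g) (?r h) x = ?r (g \<otimes>\<^bsub>P\<^esub> h) x" if "x \<in> \<Omega> - {p}" for x
        using that gh' fixer_maps[OF gh(2) that] by (simp add: compose_def)
    qed (rule compose_extensional, rule restrict_extensional)
    finally show ?thesis .
  qed
  have one_fixer: "\<one>\<^bsub>P\<^esub> \<in> fixer {p}" using p by (simp add: fixer_def)
  have r_one: "?r \<one>\<^bsub>P\<^esub> = \<one>\<^bsub>?B\<^esub>"
    by (rule extensionalityI[of _ "\<Omega> - {p}"]) (simp_all add: BijGroup_def)
  show "?r ` fixer {p} \<subseteq> carrier ?B" using r_Bij by (auto simp: BijGroup_def)
  show "?r ` fixer {p} \<noteq> {}" using one_fixer by blast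
  show "a \<otimes>\<^bsub>?B\<^esub> b \<in> ?r ` fixer {p}" if "a \<in> ?r ` fixer {p}" "b \<in> ?r ` fixer {p}" for a b
  proof -
    from that(1) obtain g where g: "g \<in> fixer {p}" "a = ?r g" unfolding image_iff by (rule bexE)
    from that(2) obtain h where h: "h \<in> fixer {p}" "b = ?r h" unfolding image_iff by (rule bexE)
    note gh = g h
    have "g \<otimes>\<^bsub>P\<^esub> h \<in> fixer {p}" using gh p by (simp add: fixer_def)
    then show ?thesis unfolding gh r_mult[OF gh(1,3)] by (rule imageI)
  qed
  show "inv\<^bsub>?B\<^esub> a \<in> ?r ` fixer {p}" if "a \<in> ?r ` fixer {p}" for a
  proof -
    from that obtain g where g: "g \<in> fixer {p}" "a = ?r g" unfolding image_iff by (rule bexE)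
    have gG: "g \<in> G" using g by (simp add: fixer_def)
    have "?r (inv\<^bsub>P\<^esub> g) \<otimes>\<^bsub>?B\<^esub> ?r g = \<one>\<^bsub>?B\<^esub>"
      unfolding r_mult[OF inv_fixer[OF g(1)] g(1)] using gG r_one P.l_inv by simp
    then have "inv\<^bsub>?B\<^esub> ?r g = ?r (inv\<^bsub>P\<^esub> g)"
      by (intro group.inv_equality[OF group_BijGroup])
        (use r_Bij g inv_fixer in \<open>simp_all add: BijGroup_def\<close>)
    then show ?thesis using inv_fixer g by simp
  qed
qed

lemma point_stabilizer_affine:
  assumes three: "multiply_transitive 3 \<Omega> G" and p: "p \<in> \<Omega>"
    and abelian: "\<And>q. q \<in> \<Omega> - {p} \<Longrightarrow> derived P (fixer {q, p}) = {\<one>\<^bsub>P\<^esub>}"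
  shows "\<exists>K :: 'a ring. field K \<and> carrier K = \<Omega> - {p} \<and>
    (\<lambda>g. restrict g (\<Omega> - {p})) ` fixer {p} = affine_maps K"
proof -
  have card: "infinite \<Omega> \<or> 3 \<le> card \<Omega>" using three unfolding multiply_transitive_def by simp
  have ex: "\<exists>x\<in>\<Omega>. x \<notin> S" if "finite S" "card S < 3" for S
    using that card by (metis card_mono finite_subset not_less order_trans subsetI leD)
  obtain q where q: "q \<in> \<Omega>" "q \<noteq> p" using ex[of "{p}"] by auto
  obtain r where r: "r \<in> \<Omega>" "r \<noteq> p" "r \<noteq> q" using ex[of "{p, q}"] q by auto
  interpret H: perm_group_on "\<Omega> - {p}" "(\<lambda>g. restrict g (\<Omega> - {p})) ` fixer {p}"
    by (rule perm_group_on.intro[OF restrict_fixer_subgroup[OF p]])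
  have two: "two_transitive_on (fixer {p}) (\<Omega> - {p})"
    by (rule two_transitive_on_fixer) (use three p in \<open>simp_all add: numeral_eq_Suc\<close>)
  interpret H: two_transitive_abelian "\<Omega> - {p}" "(\<lambda>g. restrict g (\<Omega> - {p})) ` fixer {p}" q r
  proof
    show "q \<in> \<Omega> - {p}" "r \<in> \<Omega> - {p}" "r \<noteq> q" using q r by auto
    show "\<exists>g\<in>(\<lambda>g. restrict g (\<Omega> - {p})) ` fixer {p}. g x = x' \<and> g y = y'"
      if xy: "x \<in> \<Omega> - {p}" "y \<in> \<Omega> - {p}" "x \<noteq> y" "x' \<in> \<Omega> - {p}" "y' \<in> \<Omega> - {p}" "x' \<noteq> y'"
      for x y x' y'
    proof -
      from two_transitive_onD[OF two xy(1,2,4,5,3,6)]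
      obtain g where "g \<in> fixer {p}" "g x = x' \<and> g y = y'" by (rule bexE)
      then show ?thesis using xy by (intro bexI[of _ "restrict g (\<Omega> - {p})"] imageI) simp_all
    qed
    show "g (h x) = h (g x)"
      if gh: "g \<in> (\<lambda>g. restrict g (\<Omega> - {p})) ` fixer {p}" "h \<in> (\<lambda>g. restrict g (\<Omega> - {p})) ` fixer {p}"
        "g q = q" "h q = q" and x: "x \<in> \<Omega> - {p}" for g h x
    proof -
      from gh(1) obtain g' where g': "g' \<in> fixer {p}" "g = restrict g' (\<Omega> - {p})"
        unfolding image_iff by (rule bexE)
      from gh(2) obtain h' where h': "h' \<in> fixer {p}" "h = restrict h' (\<Omega> - {p})"
        unfolding image_iff by (rule bexE)
      have "g' \<in> fixer {q, p}" "h' \<in> fixer {q, p}" using g' h' gh q by (simp_all add: fixer_def)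
      then have "g' (h' x) = h' (g' x)" using fixer_comm[OF abelian[of q]] q x by simp
      moreover have "g x \<in> \<Omega> - {p}" "h x \<in> \<Omega> - {p}" using H.closed gh x by blast+
      ultimately show ?thesis using x g' h' by simp
    qed
  qed
  show ?thesis by (rule H.eq_affine_maps)
qed

end

text \<open>The point \<open>pole\<close> is the point at infinity of the projective line over \<open>K\<close>.\<close>
locale projective_perm_group = perm_group_on \<Omega> G + field K
  for \<Omega> :: "'a set" and G and K :: "'a ring" (structure) +
  fixes pole :: 'a
  assumes pole_in [simp, intro]: "pole \<in> \<Omega>"
    and carrier_K: "carrier K = \<Omega> - {pole}"
    and three_transitive: "multiply_transitive 3 \<Omega> G"
    and stabilizer_affine: "(\<lambda>g. restrict g (carrier K)) ` fixer {pole} = affine_maps K"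
begin

lemma in_Omega_iff: "x \<in> \<Omega> \<longleftrightarrow> x = pole \<or> x \<in> carrier K"
  using carrier_K by auto

lemma pole_notin [simp]: "pole \<notin> carrier K" "x \<in> carrier K \<Longrightarrow> x \<noteq> pole"
  "x \<in> carrier K \<Longrightarrow> pole \<noteq> x"
  using carrier_K by auto

lemma K_sub [simp]: "x \<in> carrier K \<Longrightarrow> x \<in> \<Omega>"
  using carrier_K by auto

lemma stabilizer_is_affine:
  assumes "g \<in> G" "g pole = pole"
  obtains a b where "a \<in> carrier K" "a \<noteq> \<zero>" "b \<in> carrier K" "\<And>x. x \<in> carrier K \<Longrightarrow> g x = a \<otimes> x \<oplus> b"
proof -
  have "restrict g (carrier K) \<in> affine_maps K"
    unfolding stabilizer_affine[symmetric] using assms by (intro imageI) (simp add: fixer_def)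
  then obtain a b where eq: "restrict g (carrier K) = (\<lambda>x\<in>carrier K. (a \<otimes> x) \<oplus> b)"
    and ab: "a \<in> Units K" "b \<in> carrier K"
    unfolding affine_maps_def mem_Collect_eq by (elim exE conjE) (rule that)
  have "g x = a \<otimes> x \<oplus> b" if "x \<in> carrier K" for x
    using fun_cong[OF eq, of x] that by simp
  then show thesis using that ab field_Units by auto
qed

lemma affine_in_G:
  assumes "a \<in> carrier K" "a \<noteq> \<zero>" "b \<in> carrier K"
  obtains g where "g \<in> G" "g pole = pole" "\<And>x. x \<in> carrier K \<Longrightarrow> g x = a \<otimes> x \<oplus> b"
proof -
  have "(\<lambda>x\<in>carrier K. (a \<otimes> x) \<oplus> b) \<in> affine_maps K"
    using assms field_Units unfolding affine_maps_def by auto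
  then have "(\<lambda>x\<in>carrier K. (a \<otimes> x) \<oplus> b) \<in> (\<lambda>g. restrict g (carrier K)) ` fixer {pole}"
    unfolding stabilizer_affine .
  then obtain g where g: "g \<in> fixer {pole}"
    and eq: "(\<lambda>x\<in>carrier K. (a \<otimes> x) \<oplus> b) = restrict g (carrier K)"
    unfolding image_iff by (rule bexE)
  have eqs: "g x = a \<otimes> x \<oplus> b" if "x \<in> carrier K" for x
    using fun_cong[OF eq, of x] that by simp
  have "g \<in> G" "g pole = pole" using g by (simp_all add: fixer_def)
  then show thesis using eqs by (rule that)
qed

lemma three_points_fixed:
  assumes g: "g \<in> G" "g pole = pole" "g \<zero> = \<zero>" "g \<one> = \<one>" and x: "x \<in> \<Omega>"
  shows "g x = x"
proof -
  obtain a b where ab: "a \<in> carrier K" "b \<in> carrier K" "\<And>x. x \<in> carrier K \<Longrightarrow> g x = a \<otimes> x \<oplus> b"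
    using stabilizer_is_affine[OF g(1,2)] by metis
  have "b = \<zero>" using ab(3)[of \<zero>] ab g by simp
  moreover from this have "a = \<one>" using ab(3)[of \<one>] ab g by simp
  ultimately show ?thesis using ab x g in_Omega_iff by auto
qed

lemma three_points_agree:
  assumes "g \<in> G" "h \<in> G" "g pole = h pole" "g \<zero> = h \<zero>" "g \<one> = h \<one>" "x \<in> \<Omega>"
  shows "g x = h x"
proof -
  have "(inv\<^bsub>P\<^esub> h \<otimes>\<^bsub>P\<^esub> g) x = x"
    by (rule three_points_fixed) (use assms in simp_all)
  then have "(inv\<^bsub>P\<^esub> h) (g x) = x" using assms by simp
  then show ?thesis using assms apply_inv_right[of h "g x"] by simp
qed

lemma three_transitiveD:
  assumes "x \<in> \<Omega>" "y \<in> \<Omega>" "z \<in> \<Omega>" "x \<noteq> y" "x \<noteq> z" "y \<noteq> z"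
  obtains g where "g \<in> G" "g pole = x" "g \<zero> = y" "g \<one> = z"
proof -
  have "\<exists>g\<in>G. map g [pole, \<zero>, \<one>] = [x, y, z]"
  proof (rule multiply_transitiveD[OF three_transitive])
    show "distinct [pole, \<zero>, \<one>]" "distinct [x, y, z]"
      using assms by simp_all
    show "set [pole, \<zero>, \<one>] \<subseteq> \<Omega>" "set [x, y, z] \<subseteq> \<Omega>" using assms by simp_all
  qed simp_all
  then obtain g where "g \<in> G" "map g [pole, \<zero>, \<one>] = [x, y, z]" by (rule bexE)
  then show thesis using that by simp
qed

text \<open>With \<open>t x = 1 - x\<close>, both \<open>s t s\<close> and \<open>t s t\<close> swap \<open>1\<close> and the pole and fix \<open>0\<close>, so they are equal.
  Their values at \<open>x\<close> give the relation that characterises the inversion.\<close>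
lemma inversion_in_G:
  obtains s where "s \<in> G" "s pole = \<zero>" "s \<zero> = pole"
    "\<And>x. \<lbrakk>x \<in> carrier K; x \<noteq> \<zero>\<rbrakk> \<Longrightarrow> s x \<in> carrier K \<and> s x \<otimes> x = \<one>"
proof -
  obtain s where s: "s \<in> G" "s pole = \<zero>" "s \<zero> = pole" "s \<one> = \<one>"
    using three_transitiveD[of \<zero> pole \<one>] pole_notin(2)[of \<zero>] pole_notin(2)[of \<one>]
    by (metis K_sub pole_in one_closed one_not_zero zero_closed)
  have s_s: "s (s x) = x" if "x \<in> \<Omega>" for x
    using three_points_fixed[of "s \<otimes>\<^bsub>P\<^esub> s" x] s that by simp
  have s_K: "s x \<in> carrier K \<and> s x \<noteq> \<zero>" if x: "x \<in> carrier K" "x \<noteq> \<zero>" for x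
  proof -
    have "s x \<noteq> pole" using s_s[of x] s x by auto
    moreover have "s x \<noteq> \<zero>" using s_s[of x] s x by auto
    moreover have "s x \<in> \<Omega>" using s x by simp
    ultimately show ?thesis using in_Omega_iff by blast
  qed
  have s_mult: "s (x \<otimes> y) = s x \<otimes> s y"
    if x: "x \<in> carrier K" "x \<noteq> \<zero>" and y: "y \<in> carrier K" "y \<noteq> \<zero>" for x y
  proof -
    obtain m where m: "m \<in> G" "m pole = pole" "\<And>z. z \<in> carrier K \<Longrightarrow> m z = x \<otimes> z"
      using affine_in_G[of x \<zero>] x by (metis m_closed r_zero zero_closed)
    have m': "s \<otimes>\<^bsub>P\<^esub> (m \<otimes>\<^bsub>P\<^esub> s) \<in> G" "(s \<otimes>\<^bsub>P\<^esub> (m \<otimes>\<^bsub>P\<^esub> s)) pole = pole" using s m x by simp_all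
    obtain a b where ab: "a \<in> carrier K" "b \<in> carrier K"
      "\<And>z. z \<in> carrier K \<Longrightarrow> (s \<otimes>\<^bsub>P\<^esub> (m \<otimes>\<^bsub>P\<^esub> s)) z = a \<otimes> z \<oplus> b"
      using stabilizer_is_affine[OF m'] by metis
    have "b = \<zero>" using ab(3)[of \<zero>] ab s m by simp
    then have eq: "s (m (s z)) = a \<otimes> z" if "z \<in> carrier K" for z
      using ab(3)[OF that] that ab s m by simp
    have a: "a = s x" using eq[of \<one>] ab s m x by simp
    have "s (m (s (s y))) = a \<otimes> s y" using eq[of "s y"] s_K y by simp
    then show ?thesis using s_s[of y] y m a by simp
  qed
  have s_rel: "s (\<one> \<ominus> s x) = \<one> \<ominus> s (\<one> \<ominus> x)" if x: "x \<in> carrier K" "x \<noteq> \<zero>" "x \<noteq> \<one>" for x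
  proof -
    have m1: "\<ominus> \<one> \<in> carrier K" "\<ominus> \<one> \<noteq> \<zero>" by (simp, metis minus_minus minus_zero one_closed one_not_zero)
    obtain t where t: "t \<in> G" "t pole = pole" "\<And>z. z \<in> carrier K \<Longrightarrow> t z = \<ominus> \<one> \<otimes> z \<oplus> \<one>"
      using affine_in_G[OF m1 one_closed] by metis
    have tz: "t z = \<one> \<ominus> z" if "z \<in> carrier K" for z
      using t(3)[OF that] that by (simp add: l_minus minus_eq a_comm)
    have t01: "t \<zero> = \<one>" "t \<one> = \<zero>" using tz[of \<zero>] tz[of \<one>] by (simp_all add: minus_eq r_neg)
    have x1: "\<one> \<ominus> x \<in> carrier K" "\<one> \<ominus> x \<noteq> \<zero>" using x by auto
    have "(s \<otimes>\<^bsub>P\<^esub> (t \<otimes>\<^bsub>P\<^esub> s)) x = (t \<otimes>\<^bsub>P\<^esub> (s \<otimes>\<^bsub>P\<^esub> t)) x"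
      by (rule three_points_agree) (use s t t01 x in simp_all)
    then have "s (t (s x)) = t (s (t x))" using s t x by simp
    then show ?thesis using tz x s_K x1 by simp
  qed
  have "s x \<otimes> x = \<one>" if "x \<in> carrier K" "x \<noteq> \<zero>" for x
    by (rule eq_inverse_if_unit_relation[of s]) (use s_K s_mult s_s s_rel that in auto)
  then have "s x \<in> carrier K \<and> s x \<otimes> x = \<one>" if "x \<in> carrier K" "x \<noteq> \<zero>" for x
    using that s_K by simp
  with s(1-3) show thesis by (rule that)
qed

end

section \<open>The projective line\<close>

context field
begin

lemma mem_GL2_iff: "(a, b, c, d) \<in> carrier (GL2 R) \<longleftrightarrow>
    a \<in> carrier R \<and> b \<in> carrier R \<and> c \<in> carrier R \<and> d \<in> carrier R \<and> a \<otimes> d \<ominus> b \<otimes> c \<noteq> \<zero>"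
  by (auto simp: GL2_def field_Units)

lemma GL2_mult: "M \<otimes>\<^bsub>GL2 R\<^esub> N = mat2_mult R M N"
  by (simp add: GL2_def)

lemma GL2_one: "\<one>\<^bsub>GL2 R\<^esub> = (\<one>, \<zero>, \<zero>, \<one>)"
  by (simp add: GL2_def)

lemma GL2_group: "group (GL2 R)"
proof (rule groupI)
  fix M N assume "M \<in> carrier (GL2 R)" "N \<in> carrier (GL2 R)"
  moreover obtain a b c d where M: "M = (a, b, c, d)" by (cases M)
  moreover obtain a' b' c' d' where N: "N = (a', b', c', d')" by (cases N)
  ultimately have c: "a \<in> carrier R" "b \<in> carrier R" "c \<in> carrier R" "d \<in> carrier R"
    "a' \<in> carrier R" "b' \<in> carrier R" "c' \<in> carrier R" "d' \<in> carrier R"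
    and n: "a \<otimes> d \<ominus> b \<otimes> c \<noteq> \<zero>" "a' \<otimes> d' \<ominus> b' \<otimes> c' \<noteq> \<zero>"
    by (simp_all add: mem_GL2_iff)
  have "(a \<otimes> a' \<oplus> b \<otimes> c') \<otimes> (c \<otimes> b' \<oplus> d \<otimes> d') \<ominus> (a \<otimes> b' \<oplus> b \<otimes> d') \<otimes> (c \<otimes> a' \<oplus> d \<otimes> c')
      = (a \<otimes> d \<ominus> b \<otimes> c) \<otimes> (a' \<otimes> d' \<ominus> b' \<otimes> c')"
    using c by algebra
  also have "\<dots> \<noteq> \<zero>" using n c by (simp add: integral_iff)
  finally show "M \<otimes>\<^bsub>GL2 R\<^esub> N \<in> carrier (GL2 R)"
    unfolding M N GL2_mult mat2_mult.simps mem_GL2_iff using c by simp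
next
  show "\<one>\<^bsub>GL2 R\<^esub> \<in> carrier (GL2 R)" unfolding GL2_one mem_GL2_iff by (simp add: minus_eq)
next
  fix L M N assume "L \<in> carrier (GL2 R)" "M \<in> carrier (GL2 R)" "N \<in> carrier (GL2 R)"
  moreover obtain a b c d where L: "L = (a, b, c, d)" by (cases L)
  moreover obtain a' b' c' d' where M: "M = (a', b', c', d')" by (cases M)
  moreover obtain a'' b'' c'' d'' where N: "N = (a'', b'', c'', d'')" by (cases N)
  ultimately have c: "a \<in> carrier R" "b \<in> carrier R" "c \<in> carrier R" "d \<in> carrier R"
    "a' \<in> carrier R" "b' \<in> carrier R" "c' \<in> carrier R" "d' \<in> carrier R"
    "a'' \<in> carrier R" "b'' \<in> carrier R" "c'' \<in> carrier R" "d'' \<in> carrier R"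
    by (simp_all add: mem_GL2_iff)
  then show "L \<otimes>\<^bsub>GL2 R\<^esub> M \<otimes>\<^bsub>GL2 R\<^esub> N = L \<otimes>\<^bsub>GL2 R\<^esub> (M \<otimes>\<^bsub>GL2 R\<^esub> N)"
    unfolding L M N GL2_mult mat2_mult.simps prod.inject by (intro conjI; algebra)
next
  fix M assume "M \<in> carrier (GL2 R)"
  moreover obtain a b c d where M: "M = (a, b, c, d)" by (cases M)
  ultimately have c: "a \<in> carrier R" "b \<in> carrier R" "c \<in> carrier R" "d \<in> carrier R"
    and n: "a \<otimes> d \<ominus> b \<otimes> c \<noteq> \<zero>"
    by (simp_all add: mem_GL2_iff)
  then show "\<one>\<^bsub>GL2 R\<^esub> \<otimes>\<^bsub>GL2 R\<^esub> M = M" unfolding M GL2_mult GL2_one by simp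
  obtain u where u: "u \<in> carrier R" "u \<otimes> (a \<otimes> d \<ominus> b \<otimes> c) = \<one>"
    using n c field_Units Units_l_inv_ex[of "a \<otimes> d \<ominus> b \<otimes> c"] by auto
  have u0: "u \<noteq> \<zero>" using u c by auto
  have "(u \<otimes> d) \<otimes> (u \<otimes> a) \<ominus> (\<ominus> (u \<otimes> b)) \<otimes> (\<ominus> (u \<otimes> c)) = u \<otimes> (u \<otimes> (a \<otimes> d \<ominus> b \<otimes> c))"
    using u(1) c by algebra
  also have "\<dots> \<noteq> \<zero>" unfolding u(2) using u u0 by simp
  finally have in_GL2: "(u \<otimes> d, \<ominus> (u \<otimes> b), \<ominus> (u \<otimes> c), u \<otimes> a) \<in> carrier (GL2 R)"
    unfolding mem_GL2_iff using c u by simp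
  have "(u \<otimes> d) \<otimes> a \<oplus> (\<ominus> (u \<otimes> b)) \<otimes> c = u \<otimes> (a \<otimes> d \<ominus> b \<otimes> c)"
    "(u \<otimes> d) \<otimes> b \<oplus> (\<ominus> (u \<otimes> b)) \<otimes> d = \<zero>"
    "(\<ominus> (u \<otimes> c)) \<otimes> a \<oplus> (u \<otimes> a) \<otimes> c = \<zero>"
    "(\<ominus> (u \<otimes> c)) \<otimes> b \<oplus> (u \<otimes> a) \<otimes> d = u \<otimes> (a \<otimes> d \<ominus> b \<otimes> c)"
    using u(1) c by algebra+
  then have "(u \<otimes> d, \<ominus> (u \<otimes> b), \<ominus> (u \<otimes> c), u \<otimes> a) \<otimes>\<^bsub>GL2 R\<^esub> M = \<one>\<^bsub>GL2 R\<^esub>"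
    unfolding M GL2_mult GL2_one mat2_mult.simps u(2) by simp
  then show "\<exists>N\<in>carrier (GL2 R). N \<otimes>\<^bsub>GL2 R\<^esub> M = \<one>\<^bsub>GL2 R\<^esub>" using in_GL2 by (rule bexI)
qed

lemma mat2_vec_mult:
  assumes "M \<in> carrier (GL2 R)" "N \<in> carrier (GL2 R)" "v \<in> carrier R \<times> carrier R"
  shows "mat2_vec R (M \<otimes>\<^bsub>GL2 R\<^esub> N) v = mat2_vec R M (mat2_vec R N v)"
proof -
  obtain a b c d where M: "M = (a, b, c, d)" by (cases M)
  obtain a' b' c' d' where N: "N = (a', b', c', d')" by (cases N)
  obtain x y where v: "v = (x, y)" by (cases v)
  have c: "a \<in> carrier R" "b \<in> carrier R" "c \<in> carrier R" "d \<in> carrier R"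
    "a' \<in> carrier R" "b' \<in> carrier R" "c' \<in> carrier R" "d' \<in> carrier R" "x \<in> carrier R" "y \<in> carrier R"
    using assms by (simp_all add: M N v mem_GL2_iff)
  then show ?thesis
    unfolding M N v GL2_mult mat2_mult.simps mat2_vec.simps prod.inject by (intro conjI; algebra)
qed

lemma mat2_vec_closed:
  "\<lbrakk>M \<in> carrier (GL2 R); v \<in> carrier R \<times> carrier R\<rbrakk> \<Longrightarrow> mat2_vec R M v \<in> carrier R \<times> carrier R"
  by (cases M, cases v) (simp add: mem_GL2_iff)

lemma mat2_vec_one: "v \<in> carrier R \<times> carrier R \<Longrightarrow> mat2_vec R \<one>\<^bsub>GL2 R\<^esub> v = v"
  by (cases v) (simp add: GL2_one)

lemma mat2_vec_nonzero:
  assumes M: "M \<in> carrier (GL2 R)" and v: "v \<in> carrier R \<times> carrier R" "v \<noteq> (\<zero>, \<zero>)"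
  shows "mat2_vec R M v \<noteq> (\<zero>, \<zero>)"
proof
  interpret GL2: group "GL2 R" by (rule GL2_group)
  assume eq: "mat2_vec R M v = (\<zero>, \<zero>)"
  have "v = mat2_vec R (inv\<^bsub>GL2 R\<^esub> M \<otimes>\<^bsub>GL2 R\<^esub> M) v"
    using M v mat2_vec_one by (simp add: GL2.l_inv)
  also have "\<dots> = mat2_vec R (inv\<^bsub>GL2 R\<^esub> M) (\<zero>, \<zero>)"
    unfolding mat2_vec_mult[OF GL2.inv_closed[OF M] M v(1)] eq ..
  also have "\<dots> = (\<zero>, \<zero>)"
  proof -
    obtain a b c d where "inv\<^bsub>GL2 R\<^esub> M = (a, b, c, d)" by (cases "inv\<^bsub>GL2 R\<^esub> M")
    then show ?thesis using GL2.inv_closed[OF M] by (simp add: mem_GL2_iff)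
  qed
  finally show False using v by simp
qed

lemma mat2_vec_line:
  assumes "M \<in> carrier (GL2 R)" "v \<in> carrier R \<times> carrier R"
  shows "mat2_vec R M ` line_through R v = line_through R (mat2_vec R M v)"
proof -
  obtain a b c d where M: "M = (a, b, c, d)" by (cases M)
  obtain x y where v: "v = (x, y)" by (cases v)
  have c: "a \<in> carrier R" "b \<in> carrier R" "c \<in> carrier R" "d \<in> carrier R" "x \<in> carrier R" "y \<in> carrier R"
    using assms by (simp_all add: M v mem_GL2_iff)
  have eq: "mat2_vec R M (t \<otimes> x, t \<otimes> y) = (t \<otimes> (a \<otimes> x \<oplus> b \<otimes> y), t \<otimes> (c \<otimes> x \<oplus> d \<otimes> y))"
    if t: "t \<in> carrier R" for t
    unfolding M mat2_vec.simps prod.inject using c t by (intro conjI; algebra)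
  have "line_through R v = (\<lambda>t. (t \<otimes> x, t \<otimes> y)) ` carrier R"
    unfolding v line_through.simps by blast
  moreover have "line_through R (mat2_vec R M v)
      = (\<lambda>t. (t \<otimes> (a \<otimes> x \<oplus> b \<otimes> y), t \<otimes> (c \<otimes> x \<oplus> d \<otimes> y))) ` carrier R"
    unfolding v M mat2_vec.simps line_through.simps by blast
  ultimately show ?thesis using eq by (simp add: image_image)
qed

lemma mem_line_through: "\<lbrakk>x \<in> carrier R; y \<in> carrier R\<rbrakk> \<Longrightarrow> (x, y) \<in> line_through R (x, y)"
  by (auto intro!: exI[of _ \<one>])

lemma line_through_scaled:
  assumes "c \<in> carrier R" "c \<noteq> \<zero>" "x \<in> carrier R" "y \<in> carrier R"
  shows "line_through R (c \<otimes> x, c \<otimes> y) = line_through R (x, y)"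
proof -
  obtain e where e: "e \<in> carrier R" "e \<otimes> c = \<one>"
    using assms field_Units Units_l_inv_ex[of c] by auto
  have "(t \<otimes> (c \<otimes> x), t \<otimes> (c \<otimes> y)) = ((t \<otimes> c) \<otimes> x, (t \<otimes> c) \<otimes> y)" if "t \<in> carrier R" for t
    using that assms by (simp add: m_assoc)
  moreover have "(t \<otimes> x, t \<otimes> y) = ((t \<otimes> e) \<otimes> (c \<otimes> x), (t \<otimes> e) \<otimes> (c \<otimes> y))" if "t \<in> carrier R" for t
  proof -
    have "(t \<otimes> e) \<otimes> (c \<otimes> z) = t \<otimes> (e \<otimes> c) \<otimes> z" if "z \<in> carrier R" for z
      using that \<open>t \<in> carrier R\<close> e(1) assms by (simp add: m_assoc)
    then show ?thesis using e that assms by simp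
  qed
  ultimately show ?thesis unfolding line_through.simps using assms e
    by (intro equalityI subsetI; clarify) (metis m_closed)+
qed

end

context projective_perm_group
begin

definition point_line :: "'a \<Rightarrow> ('a \<times> 'a) set"
  where "point_line x = (if x = pole then line_through K (\<one>, \<zero>) else line_through K (x, \<one>))"

lemma line_eq_point_line:
  assumes x: "x \<in> carrier K" and y: "y \<in> carrier K" and nz: "(x, y) \<noteq> (\<zero>, \<zero>)"
  shows "\<exists>w\<in>\<Omega>. line_through K (x, y) = point_line w"
proof (cases "y = \<zero>")
  case True
  then have "line_through K (x, y) = point_line pole"
    using line_through_scaled[of x \<one> \<zero>] x nz by (simp add: point_line_def)
  then show ?thesis by (rule bexI) simp
next
  case False
  obtain e where e: "e \<in> carrier K" "y \<otimes> e = \<one>"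
    using False y field_Units Units_r_inv_ex[of y] by auto
  have "y \<otimes> (e \<otimes> x) = y \<otimes> e \<otimes> x" using e(1) x y by algebra
  then have "y \<otimes> (e \<otimes> x) = x" using e(2) x by simp
  then have "line_through K (x, y) = point_line (e \<otimes> x)"
    using line_through_scaled[of y "e \<otimes> x" \<one>] False x y e(1) by (simp add: point_line_def)
  then show ?thesis by (rule bexI) (use e x in simp)
qed

lemma bij_point_line: "bij_betw point_line \<Omega> (proj_line K)"
proof (rule bij_betwI')
  fix x y assume xy: "x \<in> \<Omega>" "y \<in> \<Omega>"
  show "point_line x = point_line y \<longleftrightarrow> x = y"
  proof
    assume eq: "point_line x = point_line y"
    consider "x = pole" "y = pole" | "x = pole" "y \<in> carrier K" | "x \<in> carrier K" "y = pole"
      | "x \<in> carrier K" "y \<in> carrier K" using xy in_Omega_iff by blast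
    then show "x = y"
    proof cases
      case 2
      then have "(y, \<one>) \<in> line_through K (\<one>, \<zero>)"
        using eq mem_line_through[of y \<one>] by (simp add: point_line_def)
      then show ?thesis by auto
    next
      case 3
      then have "(x, \<one>) \<in> line_through K (\<one>, \<zero>)"
        using eq mem_line_through[of x \<one>] by (simp add: point_line_def)
      then show ?thesis by auto
    next
      case 4
      then have "(x, \<one>) \<in> line_through K (y, \<one>)"
        using eq mem_line_through[of x \<one>] by (simp add: point_line_def)
      then show ?thesis using 4 by auto
    qed simp
  qed simp
next
  fix x assume x: "x \<in> \<Omega>"
  show "point_line x \<in> proj_line K"
  proof (cases "x = pole")
    case True
    show ?thesis unfolding proj_line_def by (rule image_eqI[of _ _ "(\<one>, \<zero>)"]) (simp_all add: point_line_def True)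
  next
    case False
    then have "x \<in> carrier K" using x in_Omega_iff by simp
    then show ?thesis
      unfolding proj_line_def by (intro image_eqI[of _ _ "(x, \<one>)"]) (simp_all add: point_line_def False)
  qed
next
  fix L assume "L \<in> proj_line K"
  then obtain v where "L = line_through K v" "v \<in> carrier K \<times> carrier K" "v \<noteq> (\<zero>, \<zero>)"
    unfolding proj_line_def by auto
  then show "\<exists>x\<in>\<Omega>. L = point_line x" using line_eq_point_line by (cases v) simp
qed

lemma matrix_point_line:
  assumes M: "M \<in> carrier (GL2 K)" and x: "x \<in> \<Omega>"
  shows "\<exists>w\<in>\<Omega>. mat2_vec K M ` point_line x = point_line w"
proof -
  have "\<exists>v. v \<in> carrier K \<times> carrier K \<and> v \<noteq> (\<zero>, \<zero>) \<and> point_line x = line_through K v"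
  proof (cases "x = pole")
    case True
    then show ?thesis by (intro exI[of _ "(\<one>, \<zero>)"]) (simp add: point_line_def)
  next
    case False
    then show ?thesis using x in_Omega_iff by (intro exI[of _ "(x, \<one>)"]) (simp add: point_line_def)
  qed
  then obtain v where v: "v \<in> carrier K \<times> carrier K" "v \<noteq> (\<zero>, \<zero>)" "point_line x = line_through K v"
    by (elim exE conjE)
  obtain a b where ab: "mat2_vec K M v = (a, b)" by (cases "mat2_vec K M v")
  have "a \<in> carrier K" "b \<in> carrier K" "(a, b) \<noteq> (\<zero>, \<zero>)"
    using mat2_vec_closed[OF M v(1)] mat2_vec_nonzero[OF M v(1,2)] ab by auto
  then have "\<exists>w\<in>\<Omega>. line_through K (a, b) = point_line w" by (rule line_eq_point_line)
  then show ?thesis unfolding v(3) mat2_vec_line[OF M v(1)] ab .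
qed

text \<open>The action of a matrix on lines, transported to \<open>\<Omega>\<close> along \<open>point_line\<close>. It is the fractional linear map
  \<open>x \<mapsto> (a x + b) / (c x + d)\<close>.\<close>
definition moebius :: "'a mat2 \<Rightarrow> 'a \<Rightarrow> 'a"
  where "moebius M = (\<lambda>x\<in>\<Omega>. inv_into \<Omega> point_line (mat2_vec K M ` point_line x))"

lemma point_line_eq_iff: "\<lbrakk>x \<in> \<Omega>; y \<in> \<Omega>\<rbrakk> \<Longrightarrow> point_line x = point_line y \<longleftrightarrow> x = y"
  using bij_betw_imp_inj_on[OF bij_point_line] by (simp add: inj_on_eq_iff)

lemma moebius:
  assumes "M \<in> carrier (GL2 K)" "x \<in> \<Omega>"
  shows "moebius M x \<in> \<Omega>" "point_line (moebius M x) = mat2_vec K M ` point_line x"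
proof -
  from matrix_point_line[OF assms]
  obtain w where w: "w \<in> \<Omega>" "mat2_vec K M ` point_line x = point_line w" by (rule bexE)
  have "inv_into \<Omega> point_line (point_line w) = w"
    using w bij_betw_imp_inj_on[OF bij_point_line] by (simp add: inv_into_f_f)
  then have "moebius M x = w" unfolding moebius_def using w assms by simp
  then show "moebius M x \<in> \<Omega>" "point_line (moebius M x) = mat2_vec K M ` point_line x"
    using w by simp_all
qed

lemma moebius_eqI:
  assumes "M \<in> carrier (GL2 K)" "x \<in> \<Omega>" "w \<in> \<Omega>" "mat2_vec K M ` point_line x = point_line w"
  shows "moebius M x = w"
  using moebius[OF assms(1,2)] assms point_line_eq_iff by simp

lemma moebius_mult:
  assumes M: "M \<in> carrier (GL2 K)" and N: "N \<in> carrier (GL2 K)" and x: "x \<in> \<Omega>"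
  shows "moebius (M \<otimes>\<^bsub>GL2 K\<^esub> N) x = moebius M (moebius N x)"
proof (rule moebius_eqI)
  show "M \<otimes>\<^bsub>GL2 K\<^esub> N \<in> carrier (GL2 K)" using M N GL2_group by (simp add: group.is_monoid monoid.m_closed)
  show "moebius M (moebius N x) \<in> \<Omega>" by (intro moebius M N x)
  have sub: "point_line x \<subseteq> carrier K \<times> carrier K"
    using x in_Omega_iff by (auto simp: point_line_def)
  have "mat2_vec K (M \<otimes>\<^bsub>GL2 K\<^esub> N) ` point_line x = (\<lambda>v. mat2_vec K M (mat2_vec K N v)) ` point_line x"
    by (rule image_cong[OF HOL.refl]) (use sub mat2_vec_mult[OF M N] in blast)
  also have "\<dots> = point_line (moebius M (moebius N x))"
    using moebius(2)[OF M moebius(1)[OF N x]] moebius(2)[OF N x] by (simp add: image_image)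
  finally show "mat2_vec K (M \<otimes>\<^bsub>GL2 K\<^esub> N) ` point_line x = point_line (moebius M (moebius N x))" .
qed (rule x)

lemma moebius_one: "x \<in> \<Omega> \<Longrightarrow> moebius \<one>\<^bsub>GL2 K\<^esub> x = x"
proof (rule moebius_eqI)
  assume x: "x \<in> \<Omega>"
  show "\<one>\<^bsub>GL2 K\<^esub> \<in> carrier (GL2 K)" using GL2_group by (simp add: group.is_monoid monoid.one_closed)
  have "point_line x \<subseteq> carrier K \<times> carrier K"
    using x in_Omega_iff by (auto simp: point_line_def)
  then have "mat2_vec K \<one>\<^bsub>GL2 K\<^esub> ` point_line x = (\<lambda>v. v) ` point_line x"
    by (intro image_cong[OF HOL.refl]) (use mat2_vec_one in blast)
  then show "mat2_vec K \<one>\<^bsub>GL2 K\<^esub> ` point_line x = point_line x" by simp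
qed simp_all

lemma moebius_finite:
  assumes M: "(a, b, c, d) \<in> carrier (GL2 K)" and x: "x \<in> carrier K" and w: "w \<in> carrier K"
    and nz: "c \<otimes> x \<oplus> d \<noteq> \<zero>" and eq: "(c \<otimes> x \<oplus> d) \<otimes> w = a \<otimes> x \<oplus> b"
  shows "moebius (a, b, c, d) x = w"
proof (rule moebius_eqI[OF M])
  have c: "a \<in> carrier K" "b \<in> carrier K" "c \<in> carrier K" "d \<in> carrier K"
    using M by (simp_all add: mem_GL2_iff)
  have "mat2_vec K (a, b, c, d) ` point_line x = line_through K (mat2_vec K (a, b, c, d) (x, \<one>))"
    using mat2_vec_line[OF M, of "(x, \<one>)"] x by (simp add: point_line_def)
  also have "mat2_vec K (a, b, c, d) (x, \<one>) = ((c \<otimes> x \<oplus> d) \<otimes> w, (c \<otimes> x \<oplus> d) \<otimes> \<one>)"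
    using c x eq by simp
  also have "line_through K \<dots> = point_line w"
    using line_through_scaled[of "c \<otimes> x \<oplus> d" w \<one>] c x w nz by (simp add: point_line_def)
  finally show "mat2_vec K (a, b, c, d) ` point_line x = point_line w" .
qed (use x w in simp_all)

lemma moebius_to_pole:
  assumes M: "(a, b, c, d) \<in> carrier (GL2 K)" and x: "x \<in> carrier K" and z: "c \<otimes> x \<oplus> d = \<zero>"
  shows "moebius (a, b, c, d) x = pole"
proof (rule moebius_eqI[OF M])
  have c: "a \<in> carrier K" "b \<in> carrier K" "c \<in> carrier K" "d \<in> carrier K"
    using M by (simp_all add: mem_GL2_iff)
  have "mat2_vec K (a, b, c, d) (x, \<one>) \<noteq> (\<zero>, \<zero>)"
    by (rule mat2_vec_nonzero[OF M]) (use x in simp_all)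
  then have nz: "a \<otimes> x \<oplus> b \<noteq> \<zero>" using z c x by simp
  have "mat2_vec K (a, b, c, d) ` point_line x = line_through K (mat2_vec K (a, b, c, d) (x, \<one>))"
    using mat2_vec_line[OF M, of "(x, \<one>)"] x by (simp add: point_line_def)
  also have "mat2_vec K (a, b, c, d) (x, \<one>) = ((a \<otimes> x \<oplus> b) \<otimes> \<one>, (a \<otimes> x \<oplus> b) \<otimes> \<zero>)"
    using c x z by simp
  also have "line_through K \<dots> = point_line pole"
    using line_through_scaled[of "a \<otimes> x \<oplus> b" \<one> \<zero>] c x nz by (simp add: point_line_def)
  finally show "mat2_vec K (a, b, c, d) ` point_line x = point_line pole" .
qed (use x in simp_all)

lemma moebius_pole:
  assumes M: "(a, b, c, d) \<in> carrier (GL2 K)"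
  shows "moebius (a, b, c, d) pole = w \<longleftrightarrow> w \<in> \<Omega> \<and> line_through K (a, c) = point_line w"
proof -
  have c: "a \<in> carrier K" "b \<in> carrier K" "c \<in> carrier K" "d \<in> carrier K"
    using M by (simp_all add: mem_GL2_iff)
  have "mat2_vec K (a, b, c, d) ` point_line pole = line_through K (mat2_vec K (a, b, c, d) (\<one>, \<zero>))"
    using mat2_vec_line[OF M, of "(\<one>, \<zero>)"] by (simp add: point_line_def)
  also have "mat2_vec K (a, b, c, d) (\<one>, \<zero>) = (a, c)" using c by simp
  finally show ?thesis using moebius[OF M pole_in] point_line_eq_iff by auto
qed

end

section \<open>The group of fractional linear maps\<close>

context projective_perm_group
begin

lemma affine_is_moebius:
  assumes "g \<in> G" "g pole = pole"
  shows "\<exists>M\<in>carrier (GL2 K). \<forall>x\<in>\<Omega>. moebius M x = g x"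
proof -
  obtain a b where ab: "a \<in> carrier K" "a \<noteq> \<zero>" "b \<in> carrier K"
    and g: "\<And>x. x \<in> carrier K \<Longrightarrow> g x = a \<otimes> x \<oplus> b"
    using stabilizer_is_affine[OF assms] by metis
  have M: "(a, b, \<zero>, \<one>) \<in> carrier (GL2 K)" unfolding mem_GL2_iff using ab by (simp add: minus_eq)
  have "moebius (a, b, \<zero>, \<one>) x = g x" if x: "x \<in> \<Omega>" for x
  proof (cases "x = pole")
    case True
    have "line_through K (a, \<zero>) = point_line pole"
      using line_through_scaled[of a \<one> \<zero>] ab by (simp add: point_line_def)
    then show ?thesis using moebius_pole[OF M] assms True by simp
  next
    case False
    then have "x \<in> carrier K" using x in_Omega_iff by simp
    then show ?thesis using g ab by (intro moebius_finite[OF M]) simp_all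
  qed
  then show ?thesis using M by (intro bexI[of _ "(a, b, \<zero>, \<one>)"] ballI)
qed

text \<open>If \<open>g\<close> moves the pole to \<open>c\<close>, the translation by \<open>-c\<close> followed by the inversion brings it back, so
  \<open>g\<close> is the product of a translation, the inversion and an affine map.\<close>
lemma perm_is_moebius:
  assumes g: "g \<in> G"
  shows "\<exists>M\<in>carrier (GL2 K). \<forall>x\<in>\<Omega>. moebius M x = g x"
proof (cases "g pole = pole")
  case True
  then show ?thesis using affine_is_moebius g by blast
next
  case False
  interpret GL2: group "GL2 K" by (rule GL2_group)
  obtain s where s: "s \<in> G" "s pole = \<zero>" "s \<zero> = pole"
    and s_inv: "\<And>x. \<lbrakk>x \<in> carrier K; x \<noteq> \<zero>\<rbrakk> \<Longrightarrow> s x \<in> carrier K \<and> s x \<otimes> x = \<one>"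
    using inversion_in_G by metis
  have S: "(\<zero>, \<one>, \<one>, \<zero>) \<in> carrier (GL2 K)"
    unfolding mem_GL2_iff by (simp add: minus_eq)
  have S_s: "moebius (\<zero>, \<one>, \<one>, \<zero>) x = s x" if x: "x \<in> \<Omega>" for x
  proof -
    consider "x = pole" | "x = \<zero>" | "x \<in> carrier K" "x \<noteq> \<zero>" using x in_Omega_iff by blast
    then show ?thesis
    proof cases
      case 1
      then show ?thesis using moebius_pole[OF S] s by (simp add: point_line_def del: line_through.simps)
    next
      case 2
      then show ?thesis using moebius_to_pole[OF S, of \<zero>] s by simp
    next
      case 3
      then show ?thesis using s_inv[OF 3] m_comm[of x "s x"]
        by (intro moebius_finite[OF S]) simp_all
    qed
  qed
  have s1: "s \<one> = \<one>" using s_inv[of \<one>] by (metis one_closed one_not_zero r_one)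
  have s_s: "s (s x) = x" if "x \<in> \<Omega>" for x
    using three_points_fixed[of "s \<otimes>\<^bsub>P\<^esub> s" x] s s1 that by simp
  define c where "c = g pole"
  have c: "c \<in> carrier K" using g False pole_in closed[of g pole] in_Omega_iff c_def by metis
  obtain t where t: "t \<in> G" "t pole = pole" "\<And>x. x \<in> carrier K \<Longrightarrow> t x = \<one> \<otimes> x \<oplus> c"
    using affine_in_G[OF one_closed one_not_zero c] by metis
  have "t \<zero> = c" using t c by simp
  then have tc: "(inv\<^bsub>P\<^esub> t) c = \<zero>" using t by (intro apply_inv_eq) simp_all
  \<comment> \<open>This element fixes the pole, and \<open>g\<close> is \<open>t\<close> after \<open>s\<close> after \<open>g'\<close>, since \<open>s\<close> is its own inverse.\<close>
  define g' where "g' = s \<otimes>\<^bsub>P\<^esub> (inv\<^bsub>P\<^esub> t \<otimes>\<^bsub>P\<^esub> g)"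
  have g': "g' \<in> G" "g' pole = pole" unfolding g'_def using s t g tc c_def by simp_all
  from affine_is_moebius[OF t(1,2)]
  obtain T where T: "T \<in> carrier (GL2 K)" "\<forall>x\<in>\<Omega>. moebius T x = t x" by (rule bexE)
  from affine_is_moebius[OF g']
  obtain A where A: "A \<in> carrier (GL2 K)" "\<forall>x\<in>\<Omega>. moebius A x = g' x" by (rule bexE)
  have "moebius (T \<otimes>\<^bsub>GL2 K\<^esub> ((\<zero>, \<one>, \<one>, \<zero>) \<otimes>\<^bsub>GL2 K\<^esub> A)) x = g x" if x: "x \<in> \<Omega>" for x
  proof -
    have "moebius (T \<otimes>\<^bsub>GL2 K\<^esub> ((\<zero>, \<one>, \<one>, \<zero>) \<otimes>\<^bsub>GL2 K\<^esub> A)) x = t (s (g' x))"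
      using moebius_mult[OF T(1) GL2.m_closed[OF S A(1)] x] moebius_mult[OF S A(1) x] x A T S_s s g'
      by simp
    also have "\<dots> = g x" unfolding g'_def using s t g x s_s by simp
    finally show ?thesis .
  qed
  then show ?thesis using T A S
    by (intro bexI[of _ "T \<otimes>\<^bsub>GL2 K\<^esub> ((\<zero>, \<one>, \<one>, \<zero>) \<otimes>\<^bsub>GL2 K\<^esub> A)"] ballI GL2.m_closed)
qed

lemma scalar_if_three_points_fixed:
  assumes M: "M \<in> carrier (GL2 K)"
    and fix3: "moebius M pole = pole" "moebius M \<zero> = \<zero>" "moebius M \<one> = \<one>"
  shows "M \<in> scalar_mats2 K"
proof -
  obtain a b c d where abcd: "M = (a, b, c, d)" by (cases M)
  have in_GL2: "(a, b, c, d) \<in> carrier (GL2 K)" using M abcd by simp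
  then have cl: "a \<in> carrier K" "b \<in> carrier K" "c \<in> carrier K" "d \<in> carrier K"
    and det: "a \<otimes> d \<ominus> b \<otimes> c \<noteq> \<zero>" by (simp_all add: mem_GL2_iff)
  have "line_through K (a, c) = line_through K (\<one>, \<zero>)"
    using moebius_pole[OF in_GL2, of pole] fix3 abcd by (simp add: point_line_def del: line_through.simps)
  then have "(a, c) \<in> line_through K (\<one>, \<zero>)" using mem_line_through[of a c] cl by simp
  then have c0: "c = \<zero>" by auto
  have d0: "d \<noteq> \<zero>" using det c0 cl by auto
  then obtain e where e: "e \<in> carrier K" "d \<otimes> e = \<one>"
    using cl field_Units Units_r_inv_ex[of d] by auto
  have scale: "d \<otimes> (e \<otimes> z) = z" if "z \<in> carrier K" for z
    using that e cl by (metis m_assoc l_one)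
  have "moebius (a, b, c, d) \<zero> = e \<otimes> b"
    by (rule moebius_finite[OF in_GL2]) (use cl c0 d0 e scale in simp_all)
  then have b0: "b = \<zero>" using fix3 abcd scale[of b] cl by simp
  have "moebius (a, b, c, d) \<one> = e \<otimes> a"
    by (rule moebius_finite[OF in_GL2]) (use cl c0 d0 b0 e scale in simp_all)
  then have "a = d" using fix3 abcd scale[of a] cl by simp
  then show ?thesis unfolding scalar_mats2_def abcd using b0 c0 d0 cl field_Units by blast
qed

lemma scalar_acts_trivially:
  assumes "M \<in> scalar_mats2 K" and x: "x \<in> \<Omega>"
  shows "M \<in> carrier (GL2 K)" "moebius M x = x"
proof -
  obtain a where a: "a \<in> carrier K" "a \<noteq> \<zero>" and M: "M = (a, \<zero>, \<zero>, a)"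
    using assms field_Units unfolding scalar_mats2_def by auto
  have in_GL2: "(a, \<zero>, \<zero>, a) \<in> carrier (GL2 K)"
    unfolding mem_GL2_iff using a by (simp add: minus_eq integral_iff)
  then show "M \<in> carrier (GL2 K)" using M by simp
  show "moebius M x = x"
  proof (cases "x = pole")
    case True
    have "line_through K (a, \<zero>) = point_line pole"
      using line_through_scaled[of a \<one> \<zero>] a by (simp add: point_line_def)
    then show ?thesis using moebius_pole[OF in_GL2] M True by simp
  next
    case False
    then have "x \<in> carrier K" using x in_Omega_iff by simp
    then show ?thesis unfolding M using a by (intro moebius_finite[OF in_GL2]) simp_all
  qed
qed

text \<open>By 3-transitivity some \<open>g\<close> in \<open>G\<close> agrees with the given map at the pole, at \<open>0\<close> and at \<open>1\<close>. It is
  itself given by a matrix, and a matrix that fixes three points is scalar.\<close>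
lemma moebius_in_G:
  assumes M: "M \<in> carrier (GL2 K)"
  shows "moebius M \<in> G"
proof -
  interpret GL2: group "GL2 K" by (rule GL2_group)
  have moebius_inv: "moebius (inv\<^bsub>GL2 K\<^esub> N) (moebius N x) = x"
    if "N \<in> carrier (GL2 K)" "x \<in> \<Omega>" for N x
    using moebius_mult[of "inv\<^bsub>GL2 K\<^esub> N" N x] that moebius_one by (simp add: GL2.l_inv)
  have inj: "moebius M x \<noteq> moebius M y" if "x \<in> \<Omega>" "y \<in> \<Omega>" "x \<noteq> y" for x y
    using moebius_inv[OF M] that by metis
  obtain g where g: "g \<in> G" "g pole = moebius M pole" "g \<zero> = moebius M \<zero>" "g \<one> = moebius M \<one>"
    using three_transitiveD[of "moebius M pole" "moebius M \<zero>" "moebius M \<one>"]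
      moebius(1)[OF M] inj[of pole \<zero>] inj[of pole \<one>] inj[of \<zero> \<one>] by (metis K_sub pole_in
        one_closed zero_closed one_not_zero pole_notin(1))
  from perm_is_moebius[OF g(1)]
  obtain N where N: "N \<in> carrier (GL2 K)" "\<forall>x\<in>\<Omega>. moebius N x = g x" by (rule bexE)
  have Q: "inv\<^bsub>GL2 K\<^esub> N \<otimes>\<^bsub>GL2 K\<^esub> M \<in> carrier (GL2 K)" using N M by simp
  have fix1: "moebius (inv\<^bsub>GL2 K\<^esub> N \<otimes>\<^bsub>GL2 K\<^esub> M) x = x" if "x \<in> \<Omega>" "g x = moebius M x" for x
    using moebius_mult[OF GL2.inv_closed[OF N(1)] M that(1)] moebius_inv[OF N(1) that(1)] N(2) that by simp
  have "inv\<^bsub>GL2 K\<^esub> N \<otimes>\<^bsub>GL2 K\<^esub> M \<in> scalar_mats2 K"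
    by (rule scalar_if_three_points_fixed[OF Q]) (use fix1 g in simp_all)
  then have triv: "moebius (inv\<^bsub>GL2 K\<^esub> N \<otimes>\<^bsub>GL2 K\<^esub> M) x = x" if "x \<in> \<Omega>" for x
    using scalar_acts_trivially that by blast
  have "M = N \<otimes>\<^bsub>GL2 K\<^esub> (inv\<^bsub>GL2 K\<^esub> N \<otimes>\<^bsub>GL2 K\<^esub> M)"
    using M N by (simp add: GL2.m_assoc[symmetric])
  then have "moebius M x = g x" if "x \<in> \<Omega>" for x
    using moebius_mult[OF N(1) Q that] triv[OF that] N(2) that by simp
  then have "moebius M = g"
    by (intro extensionalityI[of _ \<Omega>] Bij_imp_extensional[OF mem_Bij[OF g(1)]]) (simp_all add: moebius_def)
  then show ?thesis using g by simp
qed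

lemma moebius_group_hom: "group_hom (GL2 K) P moebius"
proof -
  interpret GL2: group "GL2 K" by (rule GL2_group)
  have "moebius (M \<otimes>\<^bsub>GL2 K\<^esub> N) = moebius M \<otimes>\<^bsub>P\<^esub> moebius N"
    if "M \<in> carrier (GL2 K)" "N \<in> carrier (GL2 K)" for M N
    by (rule perm_eqI) (use that moebius_in_G moebius_mult in simp_all)
  then have "moebius \<in> hom (GL2 K) P" using moebius_in_G by (simp add: hom_def Pi_iff)
  then show ?thesis
    by (intro group_hom.intro group_hom_axioms.intro GL2_group group_P)
qed

lemma moebius_kernel: "kernel (GL2 K) P moebius = scalar_mats2 K"
proof (intro equalityI subsetI)
  fix M assume "M \<in> kernel (GL2 K) P moebius"
  then have "M \<in> carrier (GL2 K)" "moebius M = \<one>\<^bsub>P\<^esub>" by (simp_all add: kernel_def)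
  then show "M \<in> scalar_mats2 K" by (intro scalar_if_three_points_fixed) simp_all
next
  fix M assume M: "M \<in> scalar_mats2 K"
  have "moebius M = \<one>\<^bsub>P\<^esub>"
    by (rule perm_eqI) (use scalar_acts_trivially[OF M] moebius_in_G[of M] pole_in in auto)
  then show "M \<in> kernel (GL2 K) P moebius"
    using scalar_acts_trivially(1)[OF M pole_in] by (simp add: kernel_def)
qed

lemma moebius_image: "moebius ` carrier (GL2 K) = G"
proof (intro equalityI subsetI)
  fix g assume g: "g \<in> G"
  from perm_is_moebius[OF g]
  obtain M where M: "M \<in> carrier (GL2 K)" "\<forall>x\<in>\<Omega>. moebius M x = g x" by (rule bexE)
  then have "moebius M = g" using moebius_in_G g by (intro perm_eqI) simp_all
  then show "g \<in> moebius ` carrier (GL2 K)" using M by blast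
qed (use moebius_in_G in blast)

theorem action_iso_PGL2: "action_iso P \<Omega> (\<lambda>g. g) (PGL2 K) (proj_line K) (PGL2_act K)"
proof -
  interpret GL2: group "GL2 K" by (rule GL2_group)
  interpret hom: group_hom "GL2 K" P moebius by (rule moebius_group_hom)
  define \<psi> where "\<psi> = (\<lambda>C. the_elem (moebius ` C))"
  have "\<psi> \<in> iso (GL2 K Mod kernel (GL2 K) P moebius) P"
    unfolding \<psi>_def by (rule hom.FactGroup_iso_set) (simp add: moebius_image)
  then have iso: "\<psi> \<in> iso (PGL2 K) P" unfolding moebius_kernel PGL2_def .
  have "normal (scalar_mats2 K) (GL2 K)" using hom.normal_kernel unfolding moebius_kernel .
  then have grp: "group (PGL2 K)" unfolding PGL2_def by (rule normal.factorgroup_is_group)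
  define h where "h = inv_into (carrier (PGL2 K)) \<psi>"
  have h: "h \<in> iso P (PGL2 K)" unfolding h_def by (rule group.iso_set_sym[OF grp iso])
  have "point_line (g x) = PGL2_act K (h g) (point_line x)" if g: "g \<in> G" and x: "x \<in> \<Omega>" for g x
  proof -
    have hg: "h g \<in> carrier (PGL2 K)" using h g by (auto simp: iso_def hom_def)
    have \<psi>h: "\<psi> (h g) = g"
      unfolding h_def by (rule f_inv_into_f) (use iso g in \<open>auto simp: iso_def bij_betw_def\<close>)
    obtain M where M: "M \<in> carrier (GL2 K)" "h g = scalar_mats2 K #>\<^bsub>GL2 K\<^esub> M"
      using hg unfolding PGL2_def FactGroup_def RCOSETS_def by auto
    have coset: "N \<in> carrier (GL2 K) \<and> moebius N = moebius M" if N: "N \<in> h g" for N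
    proof -
      obtain S where S: "S \<in> scalar_mats2 K" "N = S \<otimes>\<^bsub>GL2 K\<^esub> M"
        using N unfolding M(2) r_coset_def by auto
      have SG: "S \<in> carrier (GL2 K)" by (rule scalar_acts_trivially(1)[OF S(1) pole_in])
      have "moebius S = \<one>\<^bsub>P\<^esub>" using S(1) unfolding moebius_kernel[symmetric] kernel_def by simp
      then have "moebius N = moebius M"
        unfolding S(2) using hom.hom_mult[OF SG M(1)] moebius_in_G[OF M(1)] by simp
      then show ?thesis using S SG M by simp
    qed
    have one: "\<one>\<^bsub>GL2 K\<^esub> \<in> scalar_mats2 K" unfolding scalar_mats2_def GL2_one by blast
    have ne: "M \<in> h g"
      unfolding M(2) r_coset_def using one M(1) by force
    have "moebius ` h g = {moebius M}" using coset ne by blast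
    then have gM: "moebius M = g" using \<psi>h unfolding \<psi>_def by simp
    have "point_line x \<in> proj_line K" using bij_point_line x by (auto simp: bij_betw_def)
    then have "PGL2_act K (h g) (point_line x) = (\<Union>N\<in>h g. mat2_vec K N ` point_line x)"
      by (simp add: PGL2_act_def)
    also have "\<dots> = (\<Union>N\<in>h g. point_line (g x))"
    proof (rule SUP_cong[OF HOL.refl])
      fix N assume "N \<in> h g"
      then show "mat2_vec K N ` point_line x = point_line (g x)"
        using coset[of N] moebius(2)[of N x] x gM by simp
    qed
    also have "\<dots> = point_line (g x)" using ne by auto
    finally show ?thesis by simp
  qed
  then show ?thesis unfolding action_iso_def
    using h bij_point_line by (intro exI[of _ h] exI[of _ point_line]) simp
qed

end

theorem theoremA1:
  fixes n :: nat and \<Omega> :: "'a set" and G :: "('a \<Rightarrow> 'a) set"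
  assumes "n > 0"
    and "subgroup G (BijGroup \<Omega>)"
    and "multiply_transitive (n + 1) \<Omega> G"
    and "\<forall>x\<in>\<Omega>. soluble_of_length_le (perm_group \<Omega> G) n
                 (stabilizer (perm_group \<Omega> G) (\<lambda>g. g) x)"
  shows
    "(n = 1 \<and> (\<exists>K :: 'a ring. field K \<and>
        action_iso (perm_group \<Omega> G) \<Omega> (\<lambda>g. g)
          (perm_group (carrier K) (affine_maps K)) (carrier K) (\<lambda>g. g))) \<or>
     (n = 2 \<and> (\<exists>K :: 'a ring. field K \<and>
        action_iso (perm_group \<Omega> G) \<Omega> (\<lambda>g. g) (PGL2 K) (proj_line K) (PGL2_act K))) \<or>
     (n = 3 \<and>
        (action_iso (perm_group \<Omega> G) \<Omega> (\<lambda>g. g) (sym_group 4) {1..4} (\<lambda>p. p) \<or>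
         action_iso (perm_group \<Omega> G) \<Omega> (\<lambda>g. g) (sym_group 5) {1..5} (\<lambda>p. p))) \<or>
     (n = 4 \<and> action_iso (perm_group \<Omega> G) \<Omega> (\<lambda>g. g) (sym_group 5) {1..5} (\<lambda>p. p))"
proof -
  interpret perm_group_on \<Omega> G by (rule perm_group_on.intro[OF assms(2)])
  note mt = assms(3)
  have card: "infinite \<Omega> \<or> n + 1 \<le> card \<Omega>" using mt unfolding multiply_transitive_def by simp
  have sol: "(derived P ^^ n) (fixer {x}) = {\<one>\<^bsub>P\<^esub>}" if "x \<in> \<Omega>" for x
  proof -
    have "fixer {x} = stabilizer P (\<lambda>g. g) x" by (simp add: fixer_def stabilizer_def)
    then show ?thesis using assms(4) that by (simp add: soluble_of_length_le_def)
  qed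
  have ex: "\<exists>x\<in>\<Omega>. x \<notin> S" if "finite S" "card S \<le> n" for S
    using that card by (metis Suc_eq_plus1 card_mono finite_subset not_less_eq_eq order_trans subsetI)
  obtain p where p: "p \<in> \<Omega>" using ex[of "{}"] by auto
  consider "n = 1" | "n = 2" | "n \<ge> 3" using assms(1) by linarith
  then show ?thesis
  proof cases
    case 1
    obtain q where q: "q \<in> \<Omega>" "q \<noteq> p" using ex[of "{p}"] 1 by auto
    have two: "two_transitive_on (fixer {}) (\<Omega> - {})"
      by (rule two_transitive_on_fixer) (use mt 1 in \<open>simp_all add: numeral_eq_Suc\<close>)
    interpret two_transitive_abelian \<Omega> G p q
    proof
      show "\<exists>g\<in>G. g x = x' \<and> g y = y'"
        if "x \<in> \<Omega>" "y \<in> \<Omega>" "x \<noteq> y" "x' \<in> \<Omega>" "y' \<in> \<Omega>" "x' \<noteq> y'" for x y x' y'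
        using two_transitive_onD[OF two, of x y x' y'] that by (simp add: fixer_def)
      have "derived P (fixer {p}) = {\<one>\<^bsub>P\<^esub>}" using sol[OF p] 1 by simp
      then show "g (h x) = h (g x)" if "g \<in> G" "h \<in> G" "g p = p" "h p = p" "x \<in> \<Omega>" for g h x
        by (rule fixer_comm) (use that in \<open>simp_all add: fixer_def\<close>)
    qed (use p q in simp_all)
    obtain K :: "'a ring" where K: "field K" "carrier K = \<Omega>" "G = affine_maps K"
      using eq_affine_maps by (elim exE conjE)
    have "action_iso P \<Omega> (\<lambda>g. g) P \<Omega> (\<lambda>g. g)"
      unfolding action_iso_def
      by (intro exI[of _ "\<lambda>g. g"] exI[of _ "\<lambda>x. x"]) (auto simp: iso_def hom_def bij_betw_def)
    then show ?thesis using 1 K by (intro disjI1 conjI exI[of _ K]) simp_all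
  next
    case 2
    have three: "multiply_transitive 3 \<Omega> G" using mt 2 by (simp add: numeral_eq_Suc)
    have abelian: "derived P (fixer {q, p}) = {\<one>\<^bsub>P\<^esub>}" if q: "q \<in> \<Omega> - {p}" for q
    proof -
      have "multiply_transitive (card {p} + 2) \<Omega> G" using three by (simp add: numeral_eq_Suc)
      then have "(derived P ^^ 1) (fixer {q, p}) = {\<one>\<^bsub>P\<^esub>}"
        by (rule derived_length_fixer_insert[rotated 2]) (use p q sol[OF p] 2 in \<open>simp_all add: numeral_2_eq_2\<close>)
      then show ?thesis by simp
    qed
    have "\<exists>K :: 'a ring. field K \<and> carrier K = \<Omega> - {p} \<and>
        (\<lambda>g. restrict g (\<Omega> - {p})) ` fixer {p} = affine_maps K"
      by (rule point_stabilizer_affine[OF three p]) (rule abelian)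
    then obtain K :: "'a ring" where K: "field K" "carrier K = \<Omega> - {p}"
      "(\<lambda>g. restrict g (\<Omega> - {p})) ` fixer {p} = affine_maps K" by (elim exE conjE)
    interpret field K by (rule K(1))
    interpret projective_perm_group \<Omega> G K p
      by unfold_locales (use p K three in simp_all)
    show ?thesis using 2 K(1) action_iso_PGL2 by blast
  next
    case 3
    have fin: "finite \<Omega>" and le5: "card \<Omega> \<le> 5" using card_le_five[OF 3 mt p sol[OF p]] by simp_all
    have "G = Bij \<Omega>"
      by (rule eq_Bij_if_highly_transitive[OF fin _ mt]) (use 3 le5 in simp)
    then have iso: "action_iso P \<Omega> (\<lambda>g. g) (sym_group (card \<Omega>)) {1..card \<Omega>} (\<lambda>p. p)"
      by (rule action_iso_sym_group[OF fin HOL.refl])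
    have "(n = 3 \<and> (card \<Omega> = 4 \<or> card \<Omega> = 5)) \<or> (n = 4 \<and> card \<Omega> = 5)"
      using card fin le5 3 by linarith
    then show ?thesis using iso by (elim disjE conjE) simp_all
  qed
qed

end
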